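(* Let $(A,\circ,[\cdot,\cdot])$ be a finite-dimensional GD algebra over $\Bbbk$. Let $B=A^{(1)}=A\circ A+[A,A]$ and let $\mathfrak n(A_{\mathrm{Lie}})$ be the nilradical of the Lie algebra $A_{\mathrm{Lie}}=(A,[\cdot,\cdot])$. Then $B$ is nilpotent as a GD algebra if and only if the following conditions hold: (1) $A$ is solvable as a GD algebra; (2) $A\circ A\subseteq\mathfrak n(A_{\mathrm{Lie}})$; (3) $(B,\circ)$ is nilpotent as a Novikov algebra; (4) the ideal $\mathcal I_{R\operatorname{ad}}(B)$ is nilpotent.
   Context: $\Bbbk$ is an algebraically closed field of characteristic $0$. A Novikov algebra is a vector space with a bilinear product $\circ$ satisfying $(x\circ y)\circ z-x\circ(y\circ z)=(y\circ x)\circ z-y\circ(x\circ z)$ and $(x\circ y)\circ z=(x\circ z)\circ y$. A Gelfand--Dorfman (GD) algebra is a triple $(A,\circ,[\cdot,\cdot])$ such that $(A,\circ)$ is a Novikov algebra, $(A,[\cdot,\cdot])$ is a Lie algebra, and for all $x,y,z\in A$: $[x,y\circ z]-[z,y\circ x]+[y,x]\circ z-[y,z]\circ x-y\circ[x,z]=0$. The GD derived series is $A^{(0)}=A$, $A^{(n+1)}=A^{(n)}\circ A^{(n)}+[A^{(n)},A^{(n)}]$ (linear spans); $A$ is solvable if $A^{(N)}=0$ for some $N\ge0$. A GD algebra $B$ is nilpotent if $B^{\langle N\rangle}=0$ for some $N\ge1$, where $B^{\langle1\rangle}=B$, $B^{\langle n+1\rangle}=\sum_{i=1}^n\bigl(B^{\langle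 i\rangle}\circ B^{\langle n+1-i\rangle}+[B^{\langle i\rangle},B^{\langle n+1-i\rangle}]\bigr)$; $(B,\circ)$ is nilpotent as a Novikov algebra if the analogous series using only $\circ$ reaches $0$. $B=A^{(1)}$ carries the induced operations. The nilradical of a Lie algebra is its largest nilpotent ideal. For a GD algebra $B$ and $x\in B$ let $L_x,R_x,\operatorname{ad}_x\in\operatorname{End}_{\Bbbk}(B)$ be $L_x(a)=x\circ a$, $R_x(a)=a\circ x$, $\operatorname{ad}_x(a)=[x,a]$. $\mathcal M(B)$ is the non-unital associative subalgebra of $\operatorname{End}_{\Bbbk}(B)$ generated by all $L_x,R_x,\operatorname{ad}_x$, $x\in B$, and $\mathcal I_{R\operatorname{ad}}(B)$ is the two-sided ideal of $\mathcal M(B)$ generated by all $R_x\operatorname{ad}_y$, $x,y\in B$. *)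

theory Defs
  imports
    "HOL-Computational_Algebra.Polynomial"
    "HOL-Library.Set_Algebras"
    "HOL-Library.Function_Algebras"
begin

(* Sums of subspaces are written with + and the big sum operator on sets from Set_Algebras. *)

definition (in vector_space) span_prod ::
    "('b \<Rightarrow> 'b \<Rightarrow> 'b) \<Rightarrow> 'b set \<Rightarrow> 'b set \<Rightarrow> 'b set"
  where "span_prod m U V = span {m u v | u v. u \<in> U \<and> v \<in> V}"

definition (in vector_space) bilinear_prod :: "('b \<Rightarrow> 'b \<Rightarrow> 'b) \<Rightarrow> bool"
  where "bilinear_prod m \<longleftrightarrow>
    (\<forall>x. Vector_Spaces.linear scale scale (\<lambda>y. m x y)) \<and>
    (\<forall>y. Vector_Spaces.linear scale scale (\<lambda>x. m x y))"

(* The series B^<n>, for n >= 1, of a product P of subspaces; the value at 0 is not used. *)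
fun power_series ::
    "('b::comm_monoid_add set \<Rightarrow> 'b set \<Rightarrow> 'b set) \<Rightarrow> 'b set \<Rightarrow> nat \<Rightarrow> 'b set"
  where
    "power_series P B 0 = B"
  | "power_series P B (Suc 0) = B"
  | "power_series P B (Suc (Suc n)) =
       (\<Sum>i = 1..Suc n. P (power_series P B i) (power_series P B (Suc (Suc n) - i)))"

locale novikov_algebra = vector_space scale
  for scale :: "'k::field \<Rightarrow> 'a::ab_group_add \<Rightarrow> 'a" (infixr \<open>*s\<close> 75) +
  fixes circ :: "'a \<Rightarrow> 'a \<Rightarrow> 'a" (infixl \<open>\<odot>\<close> 70)
  assumes circ_bilinear: "bilinear_prod circ"
    and left_symmetric:
      "(x \<odot> y) \<odot> z - x \<odot> (y \<odot> z) = (y \<odot> x) \<odot> z - y \<odot> (x \<odot> z)"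
    and right_commutative: "(x \<odot> y) \<odot> z = (x \<odot> z) \<odot> y"
begin

definition novikov_nilpotent :: "'a set \<Rightarrow> bool"
  where "novikov_nilpotent B \<longleftrightarrow> (\<exists>N\<ge>1. power_series (span_prod circ) B N = {0})"

end

locale lie_algebra = vector_space scale
  for scale :: "'k::field \<Rightarrow> 'a::ab_group_add \<Rightarrow> 'a" (infixr \<open>*s\<close> 75) +
  fixes bracket :: "'a \<Rightarrow> 'a \<Rightarrow> 'a"
  assumes bracket_bilinear: "bilinear_prod bracket"
    and bracket_self: "bracket x x = 0"
    and jacobi:
      "bracket x (bracket y z) + bracket y (bracket z x) + bracket z (bracket x y) = 0"
begin

definition lie_ideal :: "'a set \<Rightarrow> bool"
  where "lie_ideal I \<longleftrightarrow> subspace I \<and> (\<forall>x. \<forall>y\<in>I. bracket x y \<in> I)"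

primrec lower_central :: "'a set \<Rightarrow> nat \<Rightarrow> 'a set"
  where
    "lower_central I 0 = I"
  | "lower_central I (Suc n) = span_prod bracket I (lower_central I n)"

definition lie_nilpotent :: "'a set \<Rightarrow> bool"
  where "lie_nilpotent I \<longleftrightarrow> (\<exists>n. lower_central I n = {0})"

(* Greatest with respect to inclusion; it exists in finite dimension because the sum of
   two nilpotent ideals is a nilpotent ideal. *)
definition nilradical :: "'a set"
  where "nilradical = (GREATEST I. lie_ideal I \<and> lie_nilpotent I)"

end

locale gd_algebra = novikov_algebra scale circ + lie_algebra scale bracket
  for scale :: "'k::field \<Rightarrow> 'a::ab_group_add \<Rightarrow> 'a" (infixr \<open>*s\<close> 75)
    and circ :: "'a \<Rightarrow> 'a \<Rightarrow> 'a" (infixl \<open>\<odot>\<close> 70)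
    and bracket :: "'a \<Rightarrow> 'a \<Rightarrow> 'a" +
  assumes gd_compatible:
    "bracket x (y \<odot> z) - bracket z (y \<odot> x) + bracket y x \<odot> z - bracket y z \<odot> x
       - y \<odot> bracket x z = 0"

sublocale gd_algebra \<subseteq> fun_space: vector_space "\<lambda>c f x. scale c (f x)"
  by standard (simp_all add: fun_eq_iff scale_right_distrib scale_left_distrib)

context gd_algebra
begin

definition gd_prod :: "'a set \<Rightarrow> 'a set \<Rightarrow> 'a set"
  where "gd_prod U V = span_prod circ U V + span_prod bracket U V"

(* The underlying space of A is the whole type. *)
primrec gd_derived :: "nat \<Rightarrow> 'a set"
  where
    "gd_derived 0 = UNIV"
  | "gd_derived (Suc n) = gd_prod (gd_derived n) (gd_derived n)"

definition gd_solvable :: bool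
  where "gd_solvable \<longleftrightarrow> (\<exists>N. gd_derived N = {0})"

definition gd_nilpotent :: "'a set \<Rightarrow> bool"
  where "gd_nilpotent B \<longleftrightarrow> (\<exists>N\<ge>1. power_series gd_prod B N = {0})"

(* Endomorphisms of a subspace B are represented by functions on the whole type that are 0
   at every point outside B, so that distinct functions are distinct endomorphisms. *)
definition End_on :: "'a set \<Rightarrow> ('a \<Rightarrow> 'a) set"
  where "End_on B = {f. (\<forall>x\<in>B. f x \<in> B) \<and> (\<forall>x. x \<notin> B \<longrightarrow> f x = 0) \<and>
    (\<forall>x\<in>B. \<forall>y\<in>B. f (x + y) = f x + f y) \<and> (\<forall>c. \<forall>x\<in>B. f (c *s x) = c *s f x)}"

definition L_on :: "'a set \<Rightarrow> 'a \<Rightarrow> 'a \<Rightarrow> 'a"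
  where "L_on B x = (\<lambda>a. if a \<in> B then x \<odot> a else 0)"

definition R_on :: "'a set \<Rightarrow> 'a \<Rightarrow> 'a \<Rightarrow> 'a"
  where "R_on B x = (\<lambda>a. if a \<in> B then a \<odot> x else 0)"

definition ad_on :: "'a set \<Rightarrow> 'a \<Rightarrow> 'a \<Rightarrow> 'a"
  where "ad_on B x = (\<lambda>a. if a \<in> B then bracket x a else 0)"

definition nonunital_subalgebra :: "'a set \<Rightarrow> ('a \<Rightarrow> 'a) set \<Rightarrow> bool"
  where "nonunital_subalgebra B M \<longleftrightarrow>
    M \<subseteq> End_on B \<and> fun_space.subspace M \<and> (\<forall>f\<in>M. \<forall>g\<in>M. f \<circ> g \<in> M)"

definition mult_algebra :: "'a set \<Rightarrow> ('a \<Rightarrow> 'a) set"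
  where "mult_algebra B =
    nonunital_subalgebra B hull (\<Union>x\<in>B. {L_on B x, R_on B x, ad_on B x})"

definition two_sided_ideal :: "('a \<Rightarrow> 'a) set \<Rightarrow> ('a \<Rightarrow> 'a) set \<Rightarrow> bool"
  where "two_sided_ideal M J \<longleftrightarrow>
    J \<subseteq> M \<and> fun_space.subspace J \<and> (\<forall>f\<in>M. \<forall>g\<in>J. f \<circ> g \<in> J \<and> g \<circ> f \<in> J)"

definition R_ad_ideal :: "'a set \<Rightarrow> ('a \<Rightarrow> 'a) set"
  where "R_ad_ideal B =
    two_sided_ideal (mult_algebra B) hull {R_on B x \<circ> ad_on B y | x y. x \<in> B \<and> y \<in> B}"

(* assoc_power J n is the power of J with exponent n + 1. *)
primrec assoc_power :: "('a \<Rightarrow> 'a) set \<Rightarrow> nat \<Rightarrow> ('a \<Rightarrow> 'a) set"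
  where
    "assoc_power J 0 = J"
  | "assoc_power J (Suc n) =
       fun_space.span {f \<circ> g | f g. f \<in> J \<and> g \<in> assoc_power J n}"

definition assoc_nilpotent :: "('a \<Rightarrow> 'a) set \<Rightarrow> bool"
  where "assoc_nilpotent J \<longleftrightarrow> (\<exists>n. assoc_power J n = {0})"

end

end

theory Submission
  imports Defs
begin

text \<open>If \<open>B\<close> is nilpotent, then all four conditions can be read off from the filtration of \<open>B\<close> by
its powers, because every operator \<open>L\<^sub>x\<close>, \<open>R\<^sub>x\<close>, \<open>ad\<^sub>x\<close> with \<open>x \<in> B\<close> raises the filtration degree.
For the condition on the nilradical one uses that \<open>B\<close> is an ideal of the Lie algebra \<open>A\<close>.

For the converse it suffices that all \<open>L\<^sub>x\<close>, \<open>R\<^sub>x\<close>, \<open>ad\<^sub>x\<close> act as zero on every composition factor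
\<open>U/W\<close> of \<open>B\<close> as a module over these operators: a composition series then shows that
long products of such operators vanish on \<open>B\<close> (\<open>descend_eventually_zero\<close>), and a power of \<open>B\<close>
with exponent \<open>2 ^ k\<close> lies in the \<open>k\<close>-th term of that descending series (\<open>gd_power_descend\<close>).
On a composition factor the operators disappear in the following order.

\<^item> The operators \<open>R\<^sub>x ad\<^sub>y\<close> generate a nilpotent ideal; its image is a submodule, and this submodule
is proper by nilpotency, hence zero (\<open>R_ad_zero_on_factor\<close>).

\<^item> The operators \<open>R\<^sub>x\<close> commute and are nilpotent, so they have a nonzero common kernel. Left-symmetry
and \<open>R\<^sub>x ad\<^sub>y = 0\<close> make this kernel a submodule, so it is everything (\<open>R_zero_on_factor\<close>).

\<^item> The compatibility axiom reads \<open>[ad\<^sub>x, L\<^sub>y] = R\<^sub>x ad\<^sub>y - ad\<^bsub>y \<odot> x\<^esub> - L\<^bsub>[y,x]\<^esub>\<close>. Once the \<open>R\<close>-term is gone,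
the operators \<open>L\<^sub>x + ad\<^sub>y\<close> form a Lie algebra, and it is solvable because commutators of operators
coming from one term of the GD derived series come from the next term. A solvable Lie algebra
acting irreducibly in characteristic 0 is commutative (\<open>L_ad_commute_on_factor\<close>).

\<^item> The \<open>L\<^sub>x\<close> are nilpotent because \<open>(B,\<circ>)\<close> is, the \<open>ad\<^sub>x\<close> because \<open>B\<close> lies in the nilradical. Commuting
nilpotent operators on an irreducible module are zero (\<open>gd_ops_zero_on_factor\<close>).

That \<open>B\<close> lies in the nilradical uses the inclusion of \<open>[A,A]\<close> in the nilradical of the solvable
Lie algebra \<open>A\<close> (\<open>bracket_in_nilradical\<close>), which again follows by looking at composition factors, now of the
adjoint module. The statement about solvable Lie algebras of operators (\<open>solvable_commutes\<close>) is the part of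
Lie's theorem that matters here. It is proved without eigenvectors and traces: a lemma of Jacobson
(\<open>jacobson_nilpotent\<close>) makes suitable commutators nilpotent, and it only differentiates a polynomial
that annihilates an operator.

Quotients \<open>U/W\<close> never appear as spaces. They are represented by pairs of invariant subspaces
\<open>W \<subseteq> U\<close>, and an identity of operators on \<open>U/W\<close> is the membership of a difference in \<open>W\<close>.\<close>

section \<open>Operators and composition factors\<close>

locale finite_dim_char_0 = finite_dimensional_vector_space scale Basis
  for scale :: "'k::field_char_0 \<Rightarrow> 'a::ab_group_add \<Rightarrow> 'a" (infixr \<open>*s\<close> 75)
    and Basis :: "'a set"
begin

abbreviation lin :: "('a \<Rightarrow> 'a) \<Rightarrow> bool"
  where "lin f \<equiv> Vector_Spaces.linear scale scale f"

lemma linI: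
  assumes "\<And>x y. f (x + y) = f x + f y" "\<And>c x. f (c *s x) = c *s f x"
  shows "lin f"
  using assms vector_space_axioms by (auto simp: Vector_Spaces.linear_iff)

lemma
  assumes "lin f"
  shows lin_add: "f (x + y) = f x + f y"
    and lin_scale: "f (c *s x) = c *s f x"
    and lin_0: "f 0 = 0"
    and lin_neg: "f (- x) = - f x"
    and lin_diff: "f (x - y) = f x - f y"
proof -
  interpret f: Vector_Spaces.linear scale scale f by fact
  show "f (x + y) = f x + f y" "f (c *s x) = c *s f x" "f 0 = 0" "f (- x) = - f x"
    "f (x - y) = f x - f y"
    by (rule f.add f.scale f.zero f.neg f.diff)+
qed

lemmas lin_simps = lin_add lin_scale lin_0 lin_neg lin_diff

lemma funpow_in: "(h ^^ n) u \<in> U" if "u \<in> U" "\<And>u. u \<in> U \<Longrightarrow> h u \<in> U"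
  using that by (induction n) auto

definition comm :: "('a \<Rightarrow> 'a) \<Rightarrow> ('a \<Rightarrow> 'a) \<Rightarrow> 'a \<Rightarrow> 'a"
  where "comm f g = (\<lambda>u. f (g u) - g (f u))"

lemma lin_comm: "lin f \<Longrightarrow> lin g \<Longrightarrow> lin (comm f g)"
  by (rule linI) (simp_all add: comm_def lin_simps scale_right_diff_distrib)

lemma lin_plus: "lin f \<Longrightarrow> lin g \<Longrightarrow> lin (\<lambda>u. f u + g u)"
  by (rule linI) (simp_all add: lin_simps scale_right_distrib)

definition invariant :: "('a \<Rightarrow> 'a) set \<Rightarrow> 'a set \<Rightarrow> bool"
  where "invariant G X \<longleftrightarrow> subspace X \<and> (\<forall>g\<in>G. \<forall>x\<in>X. g x \<in> X)"

text \<open>Irreducibility of the factor \<open>U/W\<close> under the operators in \<open>G\<close>.\<close>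
definition adjacent :: "('a \<Rightarrow> 'a) set \<Rightarrow> 'a set \<Rightarrow> 'a set \<Rightarrow> bool"
  where "adjacent G W U \<longleftrightarrow> invariant G W \<and> invariant G U \<and> W \<subset> U \<and>
    (\<forall>X. invariant G X \<and> W \<subseteq> X \<and> X \<subseteq> U \<longrightarrow> X = W \<or> X = U)"

lemma adjacentD:
  assumes "adjacent G W U"
  shows "subspace W" "subspace U" "W \<subseteq> U" "W \<noteq> U" "invariant G U" "invariant G W"
    "\<And>g u. g \<in> G \<Longrightarrow> u \<in> U \<Longrightarrow> g u \<in> U" "\<And>g u. g \<in> G \<Longrightarrow> u \<in> W \<Longrightarrow> g u \<in> W"
    "\<And>X. invariant G X \<Longrightarrow> W \<subseteq> X \<Longrightarrow> X \<subseteq> U \<Longrightarrow> X = W \<or> X = U"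
  using assms by (auto simp: adjacent_def invariant_def)

section \<open>Commuting nilpotent operators\<close>

text \<open>Take a minimal \<open>H\<close>-invariant subspace \<open>X\<close> strictly above \<open>W\<close>. For \<open>h \<in> H\<close> the subspace \<open>h X + W\<close> is
\<open>H\<close>-invariant because the operators commute, and it differs from \<open>X\<close> because \<open>h\<close> is nilpotent. By
minimality \<open>h X \<subseteq> W\<close>, so all of \<open>X\<close> is annihilated modulo \<open>W\<close>.\<close>
lemma common_kernel:
  assumes W: "subspace W" and U: "subspace U" and WU: "W \<subset> U"
    and lin: "\<And>h. h \<in> H \<Longrightarrow> lin h"
    and HU: "\<And>h u. h \<in> H \<Longrightarrow> u \<in> U \<Longrightarrow> h u \<in> U"
    and HW: "\<And>h u. h \<in> H \<Longrightarrow> u \<in> W \<Longrightarrow> h u \<in> W"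
    and commute: "\<And>h h' u. h \<in> H \<Longrightarrow> h' \<in> H \<Longrightarrow> u \<in> U \<Longrightarrow> comm h h' u \<in> W"
    and nilp: "\<And>h. h \<in> H \<Longrightarrow> \<exists>n. \<forall>u\<in>U. (h ^^ n) u \<in> W"
  shows "\<exists>u\<in>U - W. \<forall>h\<in>H. h u \<in> W"
proof -
  define good where "good X \<longleftrightarrow> subspace X \<and> W \<subset> X \<and> X \<subseteq> U \<and> (\<forall>h\<in>H. \<forall>x\<in>X. h x \<in> X)" for X
  have "good U" using U WU HU by (auto simp: good_def)
  then obtain X where X: "good X" and min: "\<And>Y. good Y \<Longrightarrow> dim X \<le> dim Y"
    using ex_has_least_nat[of good U dim] by blast
  have sX: "subspace X" and WX: "W \<subset> X" and XU: "X \<subseteq> U"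
    and HX: "\<And>h x. h \<in> H \<Longrightarrow> x \<in> X \<Longrightarrow> h x \<in> X"
    using X by (auto simp: good_def)
  have "h x \<in> W" if h: "h \<in> H" and x: "x \<in> X" for h x
  proof (rule ccontr)
    assume hx: "h x \<notin> W"
    define Y where "Y = {h x + w | x w. x \<in> X \<and> w \<in> W}"
    interpret h: Vector_Spaces.linear scale scale h by (rule lin[OF h])
    have Y_eq: "Y = {x + y | x y. x \<in> h ` X \<and> y \<in> W}"
      by (auto simp: Y_def)
    have sY: "subspace Y"
      unfolding Y_eq by (intro subspace_sums W h.subspace_image sX)
    have WY: "W \<subset> Y"
    proof
      show "W \<subseteq> Y"
      proof
        fix w assume "w \<in> W"
        then have "w = h 0 + w \<and> 0 \<in> X \<and> w \<in> W" by (simp add: h.zero subspace_0[OF sX])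
        then show "w \<in> Y" unfolding Y_def by blast
      qed
      have "h x = h x + 0 \<and> 0 \<in> W" by (simp add: subspace_0[OF W])
      then have "h x \<in> Y" using x unfolding Y_def by blast
      then show "W \<noteq> Y" using hx by auto
    qed
    have YX: "Y \<subseteq> X"
      using HX[OF h] WX by (auto simp: Y_def intro!: subspace_add[OF sX])
    have "g y \<in> Y" if g: "g \<in> H" and y: "y \<in> Y" for g y
    proof -
      obtain x' w where x': "x' \<in> X" "w \<in> W" "y = h x' + w"
        using y by (auto simp: Y_def)
      have "g y = h (g x') + (comm g h x' + g w)"
        by (simp add: x' comm_def lin_simps[OF lin[OF g]])
      moreover have "comm g h x' + g w \<in> W"
        using commute[OF g h] x' XU HW[OF g] by (auto intro!: subspace_add[OF W])
      moreover have "g x' \<in> X" using HX g x' by auto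
      ultimately show ?thesis unfolding Y_def by blast
    qed
    then have "good Y" using sY WY YX XU by (auto simp: good_def)
    then have "dim X \<le> dim Y" by (rule min)
    then have "Y = X" using subspace_dim_equal[OF sY sX YX] by simp
    \<comment> \<open>Now \<open>X = h X + W\<close>, hence \<open>X = h\<^sup>n X + W\<close> for all \<open>n\<close>, against nilpotency.\<close>
    have pow: "\<exists>x'\<in>X. x - (h ^^ n) x' \<in> W" if "x \<in> X" for n x
      using that
    proof (induction n arbitrary: x)
      case 0
      then show ?case by (intro bexI[of _ x]) (auto simp: subspace_0[OF W])
    next
      case (Suc n)
      have "x \<in> Y" using Suc.prems \<open>Y = X\<close> by simp
      then obtain x1 w where x1: "x1 \<in> X" "w \<in> W" "x = h x1 + w"
        by (auto simp: Y_def)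
      obtain x2 where x2: "x2 \<in> X" "x1 - (h ^^ n) x2 \<in> W"
        using Suc.IH[OF x1(1)] by auto
      have "x - (h ^^ Suc n) x2 = h (x1 - (h ^^ n) x2) + w"
        by (simp add: x1 h.diff)
      also have "\<dots> \<in> W" using HW[OF h x2(2)] x1 by (intro subspace_add[OF W])
      finally show ?case using x2 by blast
    qed
    obtain n where n: "\<And>u. u \<in> U \<Longrightarrow> (h ^^ n) u \<in> W" using nilp[OF h] by auto
    have "X \<subseteq> W"
    proof
      fix x assume "x \<in> X"
      then obtain x' where "x' \<in> X" "x - (h ^^ n) x' \<in> W" using pow by blast
      then show "x \<in> W" using subspace_add[OF W, of "x - (h ^^ n) x'" "(h ^^ n) x'"] n XU by auto
    qed
    then show False using WX by auto
  qed
  then show ?thesis using WX XU by blast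
qed

text \<open>The common kernel on an irreducible factor is nonzero by the previous lemma, and it is a submodule by
the last assumption; hence it is the whole factor. This is how operators are shown to vanish
throughout.\<close>
lemma adjacent_kernel:
  assumes adj: "adjacent G W U"
    and lin: "\<And>h. h \<in> H \<Longrightarrow> lin h"
    and HU: "\<And>h u. h \<in> H \<Longrightarrow> u \<in> U \<Longrightarrow> h u \<in> U"
    and HW: "\<And>h u. h \<in> H \<Longrightarrow> u \<in> W \<Longrightarrow> h u \<in> W"
    and commute: "\<And>h h' u. h \<in> H \<Longrightarrow> h' \<in> H \<Longrightarrow> u \<in> U \<Longrightarrow> comm h h' u \<in> W"
    and nilp: "\<And>h. h \<in> H \<Longrightarrow> \<exists>n. \<forall>u\<in>U. (h ^^ n) u \<in> W"
    and stable: "\<And>g h u. g \<in> G \<Longrightarrow> h \<in> H \<Longrightarrow> u \<in> U \<Longrightarrow> (\<And>h'. h' \<in> H \<Longrightarrow> h' u \<in> W)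
      \<Longrightarrow> h (g u) \<in> W"
    and h: "h \<in> H" and u: "u \<in> U"
  shows "h u \<in> W"
proof -
  note W = adjacentD(1)[OF adj] and U = adjacentD(2)[OF adj]
  define K where "K = {u \<in> U. \<forall>h\<in>H. h u \<in> W}"
  have "subspace K"
    unfolding subspace_def K_def
    using subspace_0[OF U] subspace_0[OF W] subspace_add[OF U] subspace_add[OF W]
      subspace_scale[OF U] subspace_scale[OF W]
    by (auto simp: lin_simps[OF lin])
  then have "invariant G K"
    using adjacentD(7)[OF adj] stable by (auto simp: invariant_def K_def)
  moreover have "W \<subseteq> K" using HW adjacentD(3)[OF adj] by (auto simp: K_def)
  moreover have "K \<subseteq> U" by (auto simp: K_def)
  ultimately have "K = W \<or> K = U" using adjacentD(9)[OF adj] by blast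
  moreover have WU: "W \<subset> U" using adjacentD(3,4)[OF adj] by blast
  have "\<exists>u\<in>U - W. \<forall>h\<in>H. h u \<in> W"
    by (rule common_kernel[OF W U WU]) (fact lin HU HW commute nilp)+
  then have "K \<noteq> W" by (auto simp: K_def)
  ultimately have "K = U" by simp
  then show ?thesis using h u by (auto simp: K_def)
qed

section \<open>Polynomials in an operator and Jacobson's lemma\<close>

definition poly_op :: "'k poly \<Rightarrow> ('a \<Rightarrow> 'a) \<Rightarrow> 'a \<Rightarrow> 'a"
  where "poly_op p f v = fold_coeffs (\<lambda>c r. c *s v + f r) p 0"

lemma poly_op_0 [simp]: "poly_op 0 f v = 0"
  by (simp add: poly_op_def)

lemma poly_op_pCons: "lin f \<Longrightarrow> poly_op (pCons c p) f v = c *s v + f (poly_op p f v)"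
  by (cases "c = 0 \<and> p = 0") (auto simp: poly_op_def lin_0)

lemma poly_op_add:
  assumes f: "lin f"
  shows "poly_op (p + q) f v = poly_op p f v + poly_op q f v"
proof (induction p arbitrary: q)
  case (pCons c p)
  obtain d r where q: "q = pCons d r" by (cases q)
  show ?case
    unfolding q by (simp add: poly_op_pCons[OF f] pCons.IH lin_simps[OF f] scale_left_distrib)
qed simp

lemma poly_op_smult: "lin f \<Longrightarrow> poly_op (smult c p) f v = c *s poly_op p f v"
  by (induction p) (simp_all add: poly_op_pCons lin_simps algebra_simps)

lemma lin_poly_op: "lin f \<Longrightarrow> lin (poly_op p f)"
  by (induction p)
    (auto intro!: linI simp: poly_op_pCons lin_simps algebra_simps)

lemma poly_op_mult: "lin f \<Longrightarrow> poly_op (p * q) f v = poly_op p f (poly_op q f v)"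
  by (induction p) (simp_all add: poly_op_pCons poly_op_add poly_op_smult)

lemma poly_op_in:
  assumes "lin f" "subspace U" "\<And>u. u \<in> U \<Longrightarrow> f u \<in> U" "v \<in> U"
  shows "poly_op p f v \<in> U"
  using assms by (induction p) (auto simp: poly_op_pCons intro: subspace_0 subspace_add subspace_scale)

text \<open>The spaces \<open>T k\<close> spanned by \<open>v, f v, \<dots>, f\<^sup>k\<^sup>-\<^sup>1 v\<close> cannot increase strictly for ever, so some
\<open>f\<^sup>k v\<close> is a combination of smaller powers.\<close>
lemma annihilator_vector:
  assumes f: "lin f"
  shows "\<exists>p. p \<noteq> 0 \<and> poly_op p f v = 0"
proof -
  define T where "T k = (\<lambda>p. poly_op p f v) ` {p. \<forall>i\<ge>k. coeff p i = 0}" for k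
  have sT: "subspace (T k)" for k
    unfolding subspace_def
  proof (intro conjI ballI allI)
    show "0 \<in> T k" unfolding T_def by (rule image_eqI[of _ _ 0]) auto
  next
    fix x y assume "x \<in> T k" "y \<in> T k"
    then obtain p q where "x = poly_op p f v" "y = poly_op q f v"
      "\<forall>i\<ge>k. coeff p i = 0" "\<forall>i\<ge>k. coeff q i = 0" by (auto simp: T_def)
    then show "x + y \<in> T k" unfolding T_def
      by (intro image_eqI[of _ _ "p + q"]) (auto simp: poly_op_add[OF f])
  next
    fix c x assume "x \<in> T k"
    then obtain p where "x = poly_op p f v" "\<forall>i\<ge>k. coeff p i = 0" by (auto simp: T_def)
    then show "c *s x \<in> T k" unfolding T_def
      by (intro image_eqI[of _ _ "smult c p"]) (auto simp: poly_op_smult[OF f])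
  qed
  have mono: "T k \<subseteq> T (Suc k)" for k by (auto simp: T_def)
  have "\<exists>k. T (Suc k) = T k"
  proof (rule ccontr)
    assume neq: "\<nexists>k. T (Suc k) = T k"
    have "k \<le> dim (T k)" for k
    proof (induction k)
      case (Suc k)
      have "T k \<subset> T (Suc k)" using neq mono by blast
      then have "dim (T k) < dim (T (Suc k))"
        using subspace_dim_equal[OF sT sT mono[of k]] by (metis not_less order_less_irrefl)
      then show ?case using Suc by simp
    qed simp
    from this[of "Suc dimension"] dim_subset_UNIV[of "T (Suc dimension)"] show False by simp
  qed
  then obtain k where k: "T (Suc k) = T k" ..
  have "poly_op (monom 1 k) f v \<in> T (Suc k)" by (auto simp: T_def)
  then obtain p where p: "poly_op (monom 1 k) f v = poly_op p f v" "\<forall>i\<ge>k. coeff p i = 0"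
    unfolding k by (auto simp: T_def)
  have "poly_op (monom 1 k + smult (-1) p) f v = 0"
    by (simp only: poly_op_add[OF f] poly_op_smult[OF f] p(1)) simp
  moreover have "coeff (monom 1 k + smult (-1) p) k = 1" using p(2) by simp
  then have "monom 1 k + smult (-1) p \<noteq> 0" by (metis coeff_0 zero_neq_one)
  ultimately show ?thesis by blast
qed

text \<open>The product of annihilators of the basis vectors annihilates the whole space.\<close>
lemma annihilator:
  assumes f: "lin f"
  shows "\<exists>p. p \<noteq> 0 \<and> (\<forall>v. poly_op p f v = 0)"
proof -
  have "\<exists>p. p \<noteq> 0 \<and> (\<forall>v\<in>S. poly_op p f v = 0)" if "finite S" for S
    using that
  proof induction
    case empty
    show ?case by (intro exI[of _ 1]) simp
  next
    case (insert x S)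
    then obtain p where p: "p \<noteq> 0" "\<And>v. v \<in> S \<Longrightarrow> poly_op p f v = 0" by auto
    obtain q where q: "q \<noteq> 0" "poly_op q f x = 0" using annihilator_vector[OF f] by auto
    have "poly_op (p * q) f x = 0"
      by (simp add: poly_op_mult[OF f] q lin_0[OF lin_poly_op[OF f]])
    moreover have "poly_op (p * q) f v = 0" if "v \<in> S" for v
      unfolding mult.commute[of p] by (simp add: poly_op_mult[OF f] p that lin_0[OF lin_poly_op[OF f]])
    ultimately show ?case using p q by (intro exI[of _ "p * q"]) auto
  qed
  from this[OF finite_Basis] obtain p where p: "p \<noteq> 0" "\<And>v. v \<in> Basis \<Longrightarrow> poly_op p f v = 0"
    by auto
  have "subspace {v. poly_op p f v = 0}"
    by (simp add: subspace_def lin_simps[OF lin_poly_op[OF f]])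
  then have "span Basis \<subseteq> {v. poly_op p f v = 0}"
    using p by (intro span_minimal) auto
  then show ?thesis using p span_Basis by auto
qed

text \<open>Write \<open>b = [x,a]\<close> and \<open>c = [x,b]\<close>; on \<open>U/W\<close> the operator \<open>b\<close> commutes with \<open>a\<close> and with \<open>c\<close>.
Start with \<open>p \<noteq> 0\<close> and \<open>p(a) b\<^sup>m = 0\<close>. Since \<open>[x, p(a)] = p'(a) b\<close> and \<open>x b\<^sup>m\<^sup>+\<^sup>1 = b\<^sup>m\<^sup>+\<^sup>1 x + (m + 1) b\<^sup>m c\<close>,
multiplying \<open>p(a) b\<^sup>m\<^sup>+\<^sup>1 = 0\<close> by \<open>x\<close> from the left leaves \<open>p'(a) b\<^sup>m\<^sup>+\<^sup>2 = 0\<close>. In characteristic 0 the derivative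
lowers the degree by exactly one, so repetition ends with a nonzero constant and a power of \<open>b\<close> vanishes.\<close>
lemma jacobson_nilpotent:
  assumes W: "subspace W" and U: "subspace U"
    and a: "lin a" "\<And>u. u \<in> U \<Longrightarrow> a u \<in> U" "\<And>u. u \<in> W \<Longrightarrow> a u \<in> W"
    and x: "lin x" "\<And>u. u \<in> U \<Longrightarrow> x u \<in> U" "\<And>u. u \<in> W \<Longrightarrow> x u \<in> W"
    and ab: "\<And>u. u \<in> U \<Longrightarrow> comm a (comm x a) u \<in> W"
    and cb: "\<And>u. u \<in> U \<Longrightarrow> comm (comm x (comm x a)) (comm x a) u \<in> W"
  shows "\<exists>n. \<forall>u\<in>U. (comm x a ^^ n) u \<in> W"
proof -
  define b where "b = comm x a"
  define c where "c = comm x b"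
  have b: "lin b" unfolding b_def by (intro lin_comm a x)
  have c: "lin c" unfolding c_def by (intro lin_comm b x)
  have bU: "b u \<in> U" if "u \<in> U" for u
    using a x that by (auto simp: b_def comm_def intro!: subspace_diff[OF U])
  have bW: "b u \<in> W" if "u \<in> W" for u
    using a x that by (auto simp: b_def comm_def intro!: subspace_diff[OF W])
  have cU: "c u \<in> U" if "u \<in> U" for u
    using bU x that by (auto simp: c_def comm_def intro!: subspace_diff[OF U])
  have bp: "(b ^^ n) u \<in> U" if "u \<in> U" for u n by (intro funpow_in that bU)
  have lbp: "lin (b ^^ n)" for n
  proof (induction n)
    case 0 show ?case by (rule linI) auto
  next
    case (Suc n) then show ?case using b by (intro linI) (auto simp: lin_simps)
  qed
  have cbn: "c ((b ^^ n) u) - (b ^^ n) (c u) \<in> W" if "u \<in> U" for n u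
  proof (induction n)
    case 0 show ?case by (simp add: subspace_0[OF W])
  next
    case (Suc n)
    have "c ((b ^^ Suc n) u) - (b ^^ Suc n) (c u)
      = comm c b ((b ^^ n) u) + b (c ((b ^^ n) u) - (b ^^ n) (c u))"
      by (simp add: comm_def lin_simps[OF b])
    also have "\<dots> \<in> W"
      using cb[OF bp[OF that]] bW[OF Suc] by (intro subspace_add[OF W]) (auto simp: b_def c_def)
    finally show ?case .
  qed
  have xbn: "x ((b ^^ Suc n) u) - ((b ^^ Suc n) (x u) + of_nat (Suc n) *s (b ^^ n) (c u)) \<in> W"
    if "u \<in> U" for n u
  proof (induction n)
    case 0 show ?case by (simp add: c_def comm_def subspace_0[OF W])
  next
    case (Suc n)
    let ?v = "(b ^^ Suc n) u"
    have xb: "x (b w) = b (x w) + c w" for w by (simp add: c_def comm_def)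
    have more: "of_nat (Suc m) *s w = of_nat m *s w + w" for m w
      by (simp add: scale_left_distrib)
    have "x (b ?v) - (b ((b ^^ Suc n) (x u)) + of_nat (Suc (Suc n)) *s b ((b ^^ n) (c u)))
      = (c ?v - (b ^^ Suc n) (c u))
        + b (x ?v - ((b ^^ Suc n) (x u) + of_nat (Suc n) *s (b ^^ n) (c u)))"
      by (simp add: xb more[of "Suc n"] lin_simps[OF b] del: of_nat_Suc)
    also have "\<dots> \<in> W" by (intro subspace_add[OF W] cbn that bW Suc)
    finally show ?case by simp
  qed
  have PU: "poly_op p a u \<in> U" if "u \<in> U" for p u by (rule poly_op_in[OF a(1) U a(2) that])
  have PW: "poly_op p a u \<in> W" if "u \<in> W" for p u by (rule poly_op_in[OF a(1) W a(3) that])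
  have bP: "poly_op p a (b u) - b (poly_op p a u) \<in> W" if "u \<in> U" for p u
  proof (induction p)
    case 0 show ?case by (simp add: lin_0[OF b] subspace_0[OF W])
  next
    case (pCons k p)
    have "poly_op (pCons k p) a (b u) - b (poly_op (pCons k p) a u)
      = a (poly_op p a (b u) - b (poly_op p a u)) + comm a b (poly_op p a u)"
      by (simp add: poly_op_pCons[OF a(1)] comm_def lin_simps[OF a(1)] lin_simps[OF b])
    also have "\<dots> \<in> W"
      using ab[OF PU[OF that]] by (intro subspace_add[OF W] a(3) pCons) (simp add: b_def)
    finally show ?case .
  qed
  have xP: "x (poly_op p a u) - (poly_op p a (x u) + poly_op (pderiv p) a (b u)) \<in> W"
    if "u \<in> U" for p u
  proof (induction p)
    case 0 show ?case by (simp add: lin_0[OF x(1)] subspace_0[OF W])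
  next
    case (pCons k p)
    have "x (poly_op (pCons k p) a u)
        - (poly_op (pCons k p) a (x u) + poly_op (pderiv (pCons k p)) a (b u))
      = a (x (poly_op p a u) - (poly_op p a (x u) + poly_op (pderiv p) a (b u)))
        - (poly_op p a (b u) - b (poly_op p a u))"
      by (simp add: poly_op_pCons[OF a(1)] pderiv_pCons poly_op_add[OF a(1)] lin_simps[OF a(1)]
          lin_simps[OF x(1)] b_def comm_def)
    also have "\<dots> \<in> W" by (intro subspace_diff[OF W] a(3) pCons bP that)
    finally show ?case .
  qed
  have "\<exists>n. \<forall>u\<in>U. (b ^^ n) u \<in> W"
    if "p \<noteq> 0" "\<And>u. u \<in> U \<Longrightarrow> poly_op p a ((b ^^ m) u) \<in> W" for p m
    using that
  proof (induction "degree p" arbitrary: p m rule: less_induct)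
    case less
    show ?case
    proof (cases "degree p = 0")
      case True
      then obtain k where k: "p = [:k:]" by (rule degree_eq_zeroE)
      then have "k \<noteq> 0" using less.prems by simp
      have "(b ^^ m) u \<in> W" if "u \<in> U" for u
      proof -
        have "k *s (b ^^ m) u \<in> W"
          using less.prems(2)[OF that] by (simp add: k poly_op_pCons[OF a(1)] lin_0[OF a(1)])
        then have "inverse k *s k *s (b ^^ m) u \<in> W" by (rule subspace_scale[OF W])
        then show ?thesis using \<open>k \<noteq> 0\<close> by simp
      qed
      then show ?thesis by blast
    next
      case False
      have "pderiv p \<noteq> 0" using False by (simp add: pderiv_eq_0_iff)
      moreover have "degree (pderiv p) < degree p" using False by (simp add: degree_pderiv)
      moreover have "poly_op (pderiv p) a ((b ^^ Suc (Suc m)) u) \<in> W" if u: "u \<in> U" for u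
      proof -
        let ?P = "poly_op p a" and ?v = "(b ^^ Suc m) u"
        note P = lin_simps[OF lin_poly_op[OF a(1)]]
        have shift: "(b ^^ Suc m) w = (b ^^ m) (b w)" for w by (simp add: funpow_swap1)
        have 1: "x (?P ?v) - (?P (x ?v) + poly_op (pderiv p) a (b ?v)) \<in> W"
          by (intro xP bp u)
        have 2: "?P (x ?v - ((b ^^ Suc m) (x u) + of_nat (Suc m) *s (b ^^ m) (c u))) \<in> W"
          by (intro PW xbn u)
        have 3: "x (?P ?v) \<in> W"
          unfolding shift by (intro x(3) less.prems(2) bU u)
        have 4: "?P ((b ^^ Suc m) (x u)) \<in> W"
          unfolding shift by (intro less.prems(2) bU x(2) u)
        have 5: "?P (of_nat (Suc m) *s (b ^^ m) (c u)) \<in> W"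
          unfolding P by (intro subspace_scale[OF W] less.prems(2) cU u)
        have "poly_op (pderiv p) a (b ?v) = x (?P ?v)
          - (x (?P ?v) - (?P (x ?v) + poly_op (pderiv p) a (b ?v)))
          - (?P (x ?v - ((b ^^ Suc m) (x u) + of_nat (Suc m) *s (b ^^ m) (c u)))
             + ?P ((b ^^ Suc m) (x u)) + ?P (of_nat (Suc m) *s (b ^^ m) (c u)))"
          by (simp only: P) (simp add: algebra_simps)
        also have "\<dots> \<in> W"
          by (intro subspace_diff[OF W] subspace_add[OF W] 1 2 3 4 5)
        finally show ?thesis by simp
      qed
      ultimately show ?thesis using less.hyps by blast
    qed
  qed
  moreover obtain p where "p \<noteq> 0" "\<And>v. poly_op p a v = 0" using annihilator[OF a(1)] by auto
  ultimately have "\<exists>n. \<forall>u\<in>U. (b ^^ n) u \<in> W"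
    using subspace_0[OF W] by metis
  then show ?thesis by (simp add: b_def)
qed

section \<open>Solvable Lie algebras of operators\<close>

text \<open>The derived series of a Lie algebra \<open>G\<close> of operators. If \<open>G\<close> is a subspace, closure under sums is enough to
obtain subspaces: a multiple of a commutator is again a commutator, of a multiple of its first entry.\<close>
inductive der :: "('a \<Rightarrow> 'a) set \<Rightarrow> nat \<Rightarrow> ('a \<Rightarrow> 'a) \<Rightarrow> bool" for G where
  der_0: "f \<in> G \<Longrightarrow> der G 0 f"
| der_comm: "der G k f \<Longrightarrow> der G k g \<Longrightarrow> der G (Suc k) (comm f g)"
| der_add: "der G (Suc k) f \<Longrightarrow> der G (Suc k) g \<Longrightarrow> der G (Suc k) (\<lambda>u. f u + g u)"

lemma comm_add_right: "lin f \<Longrightarrow> comm f (\<lambda>u. g u + h u) = (\<lambda>u. comm f g u + comm f h u)"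
  by (simp add: comm_def fun_eq_iff lin_add)

lemma comm_jacobi:
  "lin f \<Longrightarrow> lin g \<Longrightarrow> lin h \<Longrightarrow>
    comm f (comm g h) = (\<lambda>u. comm (comm f g) h u + comm g (comm f h) u)"
  by (simp add: comm_def fun_eq_iff lin_diff)

lemma der_in:
  assumes "der G k f"
    and "\<And>f g. f \<in> G \<Longrightarrow> g \<in> G \<Longrightarrow> (\<lambda>u. f u + g u) \<in> G"
    and "\<And>f g. f \<in> G \<Longrightarrow> g \<in> G \<Longrightarrow> comm f g \<in> G"
  shows "f \<in> G"
  using assms by induction auto

lemma der_ideal:
  assumes f: "der G k f" and g: "g \<in> G"
    and lin: "\<And>f. f \<in> G \<Longrightarrow> lin f"
    and add: "\<And>f g. f \<in> G \<Longrightarrow> g \<in> G \<Longrightarrow> (\<lambda>u. f u + g u) \<in> G"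
    and comm: "\<And>f g. f \<in> G \<Longrightarrow> g \<in> G \<Longrightarrow> comm f g \<in> G"
  shows "der G k (comm g f)"
  using f
proof induction
  case (der_0 f)
  then show ?case by (intro der.der_0 comm g)
next
  case (der_comm k f f')
  have "f \<in> G" "f' \<in> G"
    by (rule der_in[OF der_comm.hyps(1)] der_in[OF der_comm.hyps(2)]; fact add comm)+
  then show ?case
    unfolding comm_jacobi[OF lin lin lin, OF g \<open>f \<in> G\<close> \<open>f' \<in> G\<close>]
    using der_comm by (intro der.der_add der.der_comm)
next
  case (der_add k f f')
  then show ?case
    unfolding comm_add_right[OF lin[OF g]] by (intro der.der_add)
qed

text \<open>The commutativity part of Lie's theorem on an irreducible module. If a term of the derived series with
index at least 2 vanishes, then so does the preceding term \<open>H\<close>: first, \<open>H\<close> is an abelian ideal, so each \<open>[g,h]\<close>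
with \<open>g \<in> G\<close>, \<open>h \<in> H\<close> is nilpotent by Jacobson's lemma, and these elements \<open>P\<close> vanish as their common kernel
is a submodule. So \<open>H\<close> is central in \<open>G\<close>. Second, the commutators \<open>Q\<close> that generate \<open>H\<close> are now central, hence
again nilpotent by Jacobson's lemma, and they vanish for the same reason.\<close>
lemma solvable_commutes:
  assumes adj: "adjacent G W U"
    and lin: "\<And>f. f \<in> G \<Longrightarrow> lin f"
    and add: "\<And>f g. f \<in> G \<Longrightarrow> g \<in> G \<Longrightarrow> (\<lambda>u. f u + g u) \<in> G"
    and comm: "\<And>f g. f \<in> G \<Longrightarrow> g \<in> G \<Longrightarrow> comm f g \<in> G"
    and solvable: "\<And>f u. der G n f \<Longrightarrow> u \<in> U \<Longrightarrow> f u \<in> W"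
    and f: "f \<in> G" and g: "g \<in> G" and u: "u \<in> U"
  shows "comm f g u \<in> W"
proof -
  note W = adjacentD(1)[OF adj] and U = adjacentD(2)[OF adj]
  note GU = adjacentD(7)[OF adj] and GW = adjacentD(8)[OF adj]
  have der_G: "f \<in> G" if "der G k f" for k f
    using that by (rule der_in) (fact add comm)+
  have ideal: "der G k (comm g f)" if "der G k f" "g \<in> G" for k f g
    using that by (rule der_ideal) (fact lin add comm)+
  have step: "\<forall>f u. der G (Suc k) f \<longrightarrow> u \<in> U \<longrightarrow> f u \<in> W"
    if kill: "\<And>f u. der G (Suc (Suc k)) f \<Longrightarrow> u \<in> U \<Longrightarrow> f u \<in> W" for k
  proof -
    define H where "H = {h. der G (Suc k) h}"
    define P where "P = {comm g h | g h. g \<in> G \<and> h \<in> H}"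
    define Q where "Q = {comm x y | x y. der G k x \<and> der G k y}"
    have HG: "h \<in> G" if "h \<in> H" for h using that by (auto simp: H_def intro: der_G)
    have GH: "comm g h \<in> H" if "g \<in> G" "h \<in> H" for g h
      using that by (auto simp: H_def intro: ideal)
    have HH: "comm h h' u \<in> W" if "h \<in> H" "h' \<in> H" "u \<in> U" for h h' u
      using that unfolding H_def by (intro kill[OF der_comm]) auto
    have PI: "comm g h \<in> P" if "g \<in> G" "h \<in> H" for g h using that by (auto simp: P_def)
    have PH: "p \<in> H" if "p \<in> P" for p using that GH by (auto simp: P_def)
    have QH: "q \<in> H" if "q \<in> Q" for q using that by (auto simp: Q_def H_def intro: der_comm)
    have P0: "p u \<in> W" if p: "p \<in> P" and u: "u \<in> U" for p u
    proof (rule adjacent_kernel[OF adj, where H = P and h = p and u = u])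
      fix p assume p: "p \<in> P"
      then obtain g h where gh: "p = comm g h" "g \<in> G" "h \<in> H" by (auto simp: P_def)
      show "\<exists>n. \<forall>u\<in>U. (p ^^ n) u \<in> W"
        unfolding gh(1)
        by (rule jacobson_nilpotent[OF W U])
          (use gh HG lin GU GW HH GH in auto)
    next
      fix g p u assume g: "g \<in> G" and p: "p \<in> P" and u: "u \<in> U"
        and killed: "\<And>p. p \<in> P \<Longrightarrow> p u \<in> W"
      obtain x h where xh: "p = comm x h" "x \<in> G" "h \<in> H" using p by (auto simp: P_def)
      have "comm g p = (\<lambda>u. comm (comm g x) h u + comm x (comm g h) u)"
        unfolding xh(1) using g xh lin HG by (intro comm_jacobi) auto
      moreover have "comm (comm g x) h u \<in> W" "comm x (comm g h) u \<in> W"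
        using xh g comm GH by (auto intro!: killed PI)
      ultimately have "comm g p u \<in> W" by (simp add: subspace_add[OF W])
      moreover have "g (p u) \<in> W" using GW g killed p by blast
      ultimately have "g (p u) - comm g p u \<in> W" by (intro subspace_diff[OF W])
      then show "p (g u) \<in> W" by (simp add: comm_def)
    qed (use p u PH HG lin GU GW HH in auto)
    have Q0: "q u \<in> W" if q: "q \<in> Q" and u: "u \<in> U" for q u
    proof (rule adjacent_kernel[OF adj, where H = Q and h = q and u = u])
      fix q assume q: "q \<in> Q"
      then obtain x y where xy: "q = comm x y" "der G k x" "der G k y" by (auto simp: Q_def)
      then have "x \<in> G" "y \<in> G" by (auto intro: der_G)
      have qH: "comm x y \<in> H" using QH q xy by auto
      have "comm y (comm x y) \<in> P" "comm x (comm x y) \<in> P"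
        using \<open>x \<in> G\<close> \<open>y \<in> G\<close> qH by (auto simp: P_def)
      show "\<exists>n. \<forall>u\<in>U. (q ^^ n) u \<in> W"
        unfolding xy(1)
      proof (rule jacobson_nilpotent[OF W U])
        fix u assume u: "u \<in> U"
        show "comm y (comm x y) u \<in> W" by (rule P0[OF _ u]) fact
        have "comm x (comm x y) (comm x y u) \<in> W"
          by (rule P0) (use \<open>comm x (comm x y) \<in> P\<close> GU HG[OF qH] u in auto)
        moreover have "comm x y (comm x (comm x y) u) \<in> W"
          by (rule GW[OF HG[OF qH]]) (use P0 \<open>comm x (comm x y) \<in> P\<close> u in auto)
        ultimately show "comm (comm x (comm x y)) (comm x y) u \<in> W"
          unfolding comm_def[of "comm x (comm x y)"] by (rule subspace_diff[OF W])
      qed (use \<open>x \<in> G\<close> \<open>y \<in> G\<close> lin GU GW in auto)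
    next
      fix g q u assume g: "g \<in> G" and q: "q \<in> Q" and u: "u \<in> U"
        and killed: "\<And>q. q \<in> Q \<Longrightarrow> q u \<in> W"
      have "comm g q u \<in> W" by (rule P0[OF _ u]) (use g q QH in \<open>auto simp: P_def\<close>)
      moreover have "g (q u) \<in> W" using GW g killed q by blast
      ultimately have "g (q u) - comm g q u \<in> W" by (intro subspace_diff[OF W])
      then show "q (g u) \<in> W" by (simp add: comm_def)
    qed (use q u QH HG lin GU GW HH in auto)
    have "f u \<in> W" if "der G j f" "j = Suc k" "u \<in> U" for j f u
      using that
    proof (induction arbitrary: u)
      case (der_comm j f g)
      then show ?case by (intro Q0) (auto simp: Q_def)
    next
      case (der_add j f g)
      then show ?case by (auto intro: subspace_add[OF W])
    qed simp
    then show ?thesis by blast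
  qed
  have "\<forall>f u. der G (Suc 0) f \<longrightarrow> u \<in> U \<longrightarrow> f u \<in> W"
    if "\<And>f u. der G (Suc k) f \<Longrightarrow> u \<in> U \<Longrightarrow> f u \<in> W" for k
    using that
  proof (induction k)
    case (Suc k)
    then show ?case using step[of k] by blast
  qed blast
  moreover have "der G (Suc 0) (comm f g)" "der G 0 (comm f g)"
    using f g comm by (auto intro: der.intros)
  ultimately show ?thesis using solvable u by (cases n) blast+
qed

section \<open>Products of operators along a composition series\<close>

primrec descend :: "('a \<Rightarrow> 'a) set \<Rightarrow> 'a set \<Rightarrow> nat \<Rightarrow> 'a set"
  where
    "descend H U 0 = U"
  | "descend H U (Suc n) = span {h u | h u. h \<in> H \<and> u \<in> descend H U n}"

lemma descend_mono: "H \<subseteq> H' \<Longrightarrow> U \<subseteq> U' \<Longrightarrow> descend H U n \<subseteq> descend H' U' n"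
proof (induction n)
  case (Suc n)
  then have "descend H U n \<subseteq> descend H' U' n" by blast
  then show ?case using Suc.prems by (auto intro!: span_mono)
qed simp

lemma descend_shift: "descend H U (Suc n) = descend H (span {h u | h u. h \<in> H \<and> u \<in> U}) n"
  by (induction n) simp_all

lemma invariantD: "invariant G X \<Longrightarrow> subspace X" "invariant G X \<Longrightarrow> g \<in> G \<Longrightarrow> x \<in> X \<Longrightarrow> g x \<in> X"
  by (auto simp: invariant_def)

lemma adjacent_below:
  assumes U: "invariant G U" "U \<noteq> {0}" and G: "\<And>g. g \<in> G \<Longrightarrow> lin g"
  shows "\<exists>W. adjacent G W U"
proof -
  let ?P = "\<lambda>W. invariant G W \<and> W \<subset> U"
  have "?P {0}"
    using U subspace_0[OF invariantD(1)[OF U(1)]] by (auto simp: invariant_def lin_0[OF G])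
  moreover have "\<forall>W. ?P W \<longrightarrow> dim W < Suc dimension" using dim_subset_UNIV le_imp_less_Suc by blast
  ultimately obtain W where W: "?P W" and max: "\<And>X. ?P X \<Longrightarrow> dim X \<le> dim W"
    using ex_has_greatest_nat[of ?P "{0}" dim "Suc dimension"] by (metis order_less_imp_le)
  have "X = W \<or> X = U" if "invariant G X" "W \<subseteq> X" "X \<subseteq> U" for X
    using that W max[of X] subspace_dim_equal[of W X] by (auto simp: invariant_def)
  then show ?thesis using W U unfolding adjacent_def by blast
qed

text \<open>If \<open>H\<close> acts as zero on every composition factor, then each application of \<open>H\<close> moves one step down in a
composition series.\<close>
lemma descend_eventually_zero:
  assumes "invariant G U" and G: "\<And>g. g \<in> G \<Longrightarrow> lin g"
    and "\<And>W X h x. adjacent G W X \<Longrightarrow> X \<subseteq> U \<Longrightarrow> h \<in> H \<Longrightarrow> x \<in> X \<Longrightarrow> h x \<in> W"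
  shows "\<exists>n. descend H U n = {0}"
  using assms(1,3)
proof (induction "dim U" arbitrary: U rule: less_induct)
  case less
  show ?case
  proof (cases "U = {0}")
    case True
    then show ?thesis by (intro exI[of _ 0]) simp
  next
    case False
    then obtain W where W: "adjacent G W U" using adjacent_below less.prems(1) G by blast
    then have "dim W < dim U"
      using adjacentD(1-4)[OF W] subspace_dim_equal[of W U] by (metis not_less)
    then obtain n where n: "descend H W n = {0}"
      using less.hyps[of W] less.prems(2) adjacentD(3,6)[OF W] by (meson subset_trans)
    have "span {h u | h u. h \<in> H \<and> u \<in> U} \<subseteq> W"
      by (rule span_minimal) (use less.prems(2)[OF W] adjacentD(1)[OF W] in auto)
    then have "descend H U (Suc n) \<subseteq> {0}"
      unfolding descend_shift n[symmetric] by (intro descend_mono) auto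
    moreover have "0 \<in> descend H U (Suc n)" by (simp add: span_zero)
    ultimately show ?thesis by blast
  qed
qed

text \<open>\<open>H U + W\<close> is a submodule. If it were all of \<open>U\<close>, then iterating would give \<open>U = H\<^sup>n U + W = W\<close>.
Linearity of \<open>H\<close> is required on \<open>U\<close> only, so that the lemma applies to endomorphisms of a subspace that are
extended by 0 to the whole space.\<close>
lemma adjacent_killed:
  assumes adj: "adjacent G W U"
    and G: "\<And>g. g \<in> G \<Longrightarrow> lin g"
    and HU: "\<And>h u. h \<in> H \<Longrightarrow> u \<in> U \<Longrightarrow> h u \<in> U"
    and HW: "\<And>h u. h \<in> H \<Longrightarrow> u \<in> W \<Longrightarrow> h u \<in> W"
    and add: "\<And>h u v. h \<in> H \<Longrightarrow> u \<in> U \<Longrightarrow> v \<in> U \<Longrightarrow> h (u + v) = h u + h v"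
    and scale: "\<And>h u c. h \<in> H \<Longrightarrow> u \<in> U \<Longrightarrow> h (c *s u) = c *s h u"
    and ideal: "\<And>g h u. g \<in> G \<Longrightarrow> h \<in> H \<Longrightarrow> u \<in> U \<Longrightarrow>
      g (h u) \<in> span ({h u | h u. h \<in> H \<and> u \<in> U} \<union> W)"
    and nilp: "descend H U n \<subseteq> W"
    and h: "h \<in> H" and u: "u \<in> U"
  shows "h u \<in> W"
proof -
  note W = adjacentD(1)[OF adj] and U = adjacentD(2)[OF adj]
  define Y where "Y = span ({h u | h u. h \<in> H \<and> u \<in> U} \<union> W)"
  have WY: "W \<subseteq> Y" by (auto simp: Y_def span_base)
  have HY: "h u \<in> Y" if "h \<in> H" "u \<in> U" for h u
    using that by (auto simp: Y_def intro!: span_base)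
  have YU: "Y \<subseteq> U"
    unfolding Y_def using HU adjacentD(3)[OF adj] U by (intro span_minimal) auto
  have "g y \<in> Y" if g: "g \<in> G" and y: "y \<in> Y" for g y
  proof -
    interpret g: Vector_Spaces.linear scale scale g by (rule G[OF g])
    have "subspace {y. g y \<in> Y}"
      by (auto simp: subspace_def g.zero g.add g.scale Y_def intro: span_zero span_add span_scale)
    moreover have "g (h u) \<in> Y" if "h \<in> H" "u \<in> U" for h u
      using ideal[OF g that] by (simp add: Y_def)
    moreover have "g w \<in> Y" if "w \<in> W" for w using WY adjacentD(8)[OF adj g that] by auto
    ultimately have "Y \<subseteq> {y. g y \<in> Y}"
      unfolding Y_def[of] by (intro span_minimal) (auto simp: Y_def)
    then show ?thesis using y by auto
  qed
  then have "Y = W \<or> Y = U"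
    using adjacentD(9)[OF adj _ WY YU] by (auto simp: invariant_def Y_def)
  then show ?thesis
  proof
    assume "Y = W"
    then show ?thesis using HY[OF h u] by simp
  next
    assume YU: "Y = U"
    have dU: "descend H U k \<subseteq> U" for k
    proof (induction k)
      case (Suc k)
      have "span {h u | h u. h \<in> H \<and> u \<in> descend H U k} \<subseteq> U"
        using Suc HU by (intro span_minimal U) auto
      then show ?case by simp
    qed simp
    have "U \<subseteq> span (descend H U k \<union> W)" for k
    proof (induction k)
      case 0 show ?case using span_base by auto
    next
      case (Suc k)
      let ?Z = "span (descend H U (Suc k) \<union> W)"
      have WZ: "W \<subseteq> ?Z" by (auto intro: span_base)
      have "h u \<in> ?Z" if h: "h \<in> H" and u: "u \<in> U" for h u
      proof -
        have "subspace {u \<in> U. h u \<in> ?Z}"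
          using subspace_0[OF U] subspace_add[OF U] subspace_scale[OF U] add[OF h] scale[OF h]
            add[OF h, of 0 0]
          by (auto simp: subspace_def span_zero intro: span_add span_scale)
        moreover have "h u \<in> ?Z" if "u \<in> descend H U k" for u
          using that h by (intro span_base UnI1) (auto intro!: span_base)
        ultimately have "span (descend H U k \<union> W) \<subseteq> {u \<in> U. h u \<in> ?Z}"
          using dU WZ HW[OF h] adjacentD(3)[OF adj] by (intro span_minimal) auto
        then show ?thesis using Suc u by auto
      qed
      then have "Y \<subseteq> ?Z" unfolding Y_def using WZ by (intro span_minimal) auto
      then show ?case using YU by simp
    qed
    from this[of n] have "U \<subseteq> span W" using nilp by (simp add: sup.absorb2)
    then have "U \<subseteq> W" using W by (simp add: span_eq_iff[THEN iffD2])
    then show ?thesis using adjacentD(3,4)[OF adj] by auto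
  qed
qed

end

section \<open>Sums of subspaces and the series of powers\<close>

lemma power_series_unfold:
  "n \<ge> 2 \<Longrightarrow> power_series P B n = (\<Sum>i = 1..n - 1. P (power_series P B i) (power_series P B (n - i)))"
  by (cases n; cases "n - 1") (auto simp del: sum.cl_ivl_Suc)

context vector_space
begin

lemma subspace_set_plus: "subspace U \<Longrightarrow> subspace V \<Longrightarrow> subspace (U + V)"
proof -
  have "U + V = {x + y | x y. x \<in> U \<and> y \<in> V}" by (auto simp: set_plus_def)
  then show "subspace U \<Longrightarrow> subspace V \<Longrightarrow> subspace (U + V)" using subspace_sums by simp
qed

lemma sum_subset_subspace:
  assumes "finite I" "subspace Z" "\<And>i. i \<in> I \<Longrightarrow> S i \<subseteq> Z"
  shows "(\<Sum>i\<in>I. S i) \<subseteq> Z"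
  using assms by (auto simp: set_sum_alt intro!: subspace_sum)

lemma subset_sum_subspaces:
  assumes "finite I" "i \<in> I" "\<And>i. i \<in> I \<Longrightarrow> 0 \<in> S i"
  shows "S i \<subseteq> (\<Sum>i\<in>I. S i)"
proof
  fix x assume "x \<in> S i"
  then have "x = (\<Sum>j\<in>I. if j = i then x else 0) \<and> (\<forall>j\<in>I. (if j = i then x else 0) \<in> S j)"
    using assms by (auto simp: sum.delta)
  then show "x \<in> (\<Sum>i\<in>I. S i)"
    unfolding set_sum_alt[OF assms(1)] by (intro CollectI exI[of _ "\<lambda>j. if j = i then x else 0"]) 
qed

lemma subspace_sum_set: "finite I \<Longrightarrow> (\<And>i. i \<in> I \<Longrightarrow> subspace (S i)) \<Longrightarrow> subspace (\<Sum>i\<in>I. S i)"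
proof (induction rule: finite_induct)
  case empty
  then show ?case by (simp add: subspace_def)
qed (simp add: subspace_set_plus)

lemma power_series_minimal:
  assumes "n \<ge> 2" "subspace Z"
    and "\<And>i. 1 \<le> i \<Longrightarrow> i < n \<Longrightarrow> P (power_series P B i) (power_series P B (n - i)) \<subseteq> Z"
  shows "power_series P B n \<subseteq> Z"
  unfolding power_series_unfold[OF assms(1)]
proof (rule sum_subset_subspace)
  fix i assume "i \<in> {1..n - 1}"
  then have "1 \<le> i" "i < n" using assms(1) by auto
  then show "P (power_series P B i) (power_series P B (n - i)) \<subseteq> Z" by (rule assms(3))
qed (use assms in auto)

lemma power_series_upper:
  assumes P: "\<And>U V. subspace (P U V)" and i: "1 \<le> i" "i < n"
  shows "P (power_series P B i) (power_series P B (n - i)) \<subseteq> power_series P B n"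
proof -
  have n: "n \<ge> 2" using i by simp
  show ?thesis
    unfolding power_series_unfold[OF n]
    by (rule subset_sum_subspaces[of _ _ "\<lambda>i. P (power_series P B i) (power_series P B (n - i))"])
      (use i P subspace_0 in auto)
qed

lemma power_series_mult:
  assumes P: "\<And>U V. subspace (P U V)" and "1 \<le> i" "1 \<le> j"
  shows "P (power_series P B i) (power_series P B j) \<subseteq> power_series P B (i + j)"
  using power_series_upper[of P i "i + j"] assms by simp

lemma subspace_power_series:
  assumes P: "\<And>U V. subspace (P U V)" and B: "subspace B"
  shows "subspace (power_series P B n)"
proof (cases "n \<ge> 2")
  case True
  then show ?thesis unfolding power_series_unfold[OF True] using P by (intro subspace_sum_set) auto
next
  case False
  then have "n = 0 \<or> n = Suc 0" by auto
  then show ?thesis using B by auto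
qed

lemma subspace_span_prod: "subspace (span_prod m U V)"
  by (simp add: span_prod_def)

lemma span_prodI: "u \<in> U \<Longrightarrow> v \<in> V \<Longrightarrow> m u v \<in> span_prod m U V"
  by (auto simp: span_prod_def intro!: span_base)

lemma span_prod_minimal:
  "subspace Z \<Longrightarrow> (\<And>u v. u \<in> U \<Longrightarrow> v \<in> V \<Longrightarrow> m u v \<in> Z) \<Longrightarrow> span_prod m U V \<subseteq> Z"
  unfolding span_prod_def by (intro span_minimal) auto

end

section \<open>The nilradical of a finite-dimensional Lie algebra\<close>

locale fd_lie_algebra = lie_algebra scale bracket + finite_dim_char_0 scale Basis
  for scale :: "'k::field_char_0 \<Rightarrow> 'a::ab_group_add \<Rightarrow> 'a"
    and bracket :: "'a \<Rightarrow> 'a \<Rightarrow> 'a" and Basis :: "'a set"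
begin

lemma lin_bracket: "lin (bracket x)" and lin_bracket_left: "lin (\<lambda>x. bracket x y)"
  using bracket_bilinear by (auto simp: bilinear_prod_def)

lemmas bracket_simps = lin_simps[OF lin_bracket] lin_simps[OF lin_bracket_left]

lemma bracket_anti: "bracket x y = - bracket y x"
proof -
  have "bracket (x + y) (x + y) = bracket x (x + y) + bracket y (x + y)"
    by (rule lin_add[OF lin_bracket_left])
  also have "\<dots> = bracket x y + bracket y x"
    by (simp add: lin_add[OF lin_bracket] bracket_self)
  finally show ?thesis by (simp add: bracket_self eq_neg_iff_add_eq_0)
qed

lemma comm_bracket: "comm (bracket x) (bracket y) = bracket (bracket x y)"
proof
  fix u
  show "comm (bracket x) (bracket y) u = bracket (bracket x y) u"
    using jacobi[of x y u]
    unfolding bracket_anti[of u x] bracket_anti[of u "bracket x y"]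
    by (simp add: comm_def bracket_simps)
qed

lemma lie_idealD:
  "lie_ideal I \<Longrightarrow> subspace I" "lie_ideal I \<Longrightarrow> y \<in> I \<Longrightarrow> bracket x y \<in> I"
  "lie_ideal I \<Longrightarrow> y \<in> I \<Longrightarrow> bracket y x \<in> I"
  using bracket_anti[of y x] subspace_neg[of I "bracket x y"] by (auto simp: lie_ideal_def)

text \<open>By \<open>adjacent_killed\<close>, an ideal that is nilpotent acts as zero on the composition factors of the adjoint module;
conversely a composition series shows that its lower central series ends. This criterion is additive in
\<open>I\<close>, which makes sums of nilpotent ideals and the derived algebra of a
solvable Lie algebra easy to handle.\<close>
lemma nilpotent_ideal_iff:
  assumes I: "lie_ideal I"
  shows "lie_nilpotent I \<longleftrightarrow> (\<forall>W U x u. adjacent (range bracket) W U \<longrightarrow> x \<in> I \<longrightarrow> u \<in> U \<longrightarrow> bracket x u \<in> W)"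
    (is "_ \<longleftrightarrow> ?kills")
proof
  assume "lie_nilpotent I"
  then obtain n where n: "lower_central I n = {0}" by (auto simp: lie_nilpotent_def)
  have le: "descend (bracket ` I) UNIV (Suc m) \<subseteq> lower_central I m" for m
  proof (induction m)
    case 0
    have "span {h u | h u. h \<in> bracket ` I \<and> u \<in> UNIV} \<subseteq> I"
      using lie_idealD[OF I] by (intro span_minimal) auto
    then show ?case by simp
  next
    case (Suc m)
    show ?case
      unfolding lower_central.simps descend.simps(2)[of _ _ "Suc m"] span_prod_def
      by (rule span_mono) (use Suc in blast)
  qed
  show ?kills
  proof (intro allI impI)
    fix W U x u assume adj: "adjacent (range bracket) W U" and x: "x \<in> I" and u: "u \<in> U"
    show "bracket x u \<in> W"
    proof (rule adjacent_killed[OF adj, where H = "bracket ` I" and n = "Suc n" and h = "bracket x" and u = u])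
      have "descend (bracket ` I) U (Suc n) \<subseteq> lower_central I n"
        by (rule subset_trans[OF descend_mono le]) auto
      also have "\<dots> \<subseteq> W" using subspace_0[OF adjacentD(1)[OF adj]] by (simp add: n)
      finally show "descend (bracket ` I) U (Suc n) \<subseteq> W" .
    next
      fix g h u assume "g \<in> range bracket" "h \<in> bracket ` I" and u: "u \<in> U"
      then obtain y x where x: "g = bracket y" "h = bracket x" "x \<in> I" by auto
      have "g (h u) = bracket (bracket y x) u + bracket x (bracket y u)"
        using fun_cong[OF comm_bracket[of y x], of u] by (simp add: x comm_def algebra_simps)
      moreover have "bracket y x \<in> I" "bracket y u \<in> U"
        using lie_idealD(2)[OF I x(3)] adjacentD(7)[OF adj _ u] by auto
      ultimately show "g (h u) \<in> span ({h u | h u. h \<in> bracket ` I \<and> u \<in> U} \<union> W)"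
        using x(3) u by (auto intro!: span_add[OF span_base span_base])
    qed (use x u adjacentD(7,8)[OF adj] in \<open>auto simp: lin_bracket bracket_simps\<close>)
  qed
next
  assume kills: ?kills
  have "\<exists>n. descend (bracket ` I) UNIV n = {0}"
    by (rule descend_eventually_zero[of "range bracket"])
      (use kills lin_bracket in \<open>auto simp: invariant_def\<close>)
  then obtain n where n: "descend (bracket ` I) UNIV n = {0}" ..
  have "lower_central I m \<subseteq> descend (bracket ` I) UNIV m" for m
  proof (induction m)
    case (Suc m)
    show ?case
      unfolding lower_central.simps descend.simps span_prod_def
      by (rule span_mono) (use Suc in blast)
  qed simp
  moreover have "0 \<in> lower_central I n"
    using subspace_0[OF lie_idealD(1)[OF I]] subspace_0[OF subspace_span_prod] by (cases n) auto
  ultimately have "lower_central I n = {0}" using n by blast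
  then show "lie_nilpotent I" by (auto simp: lie_nilpotent_def)
qed

lemma nilpotent_ideal_sum:
  assumes I: "lie_ideal I" "lie_nilpotent I" and J: "lie_ideal J" "lie_nilpotent J"
  shows "lie_ideal (I + J)" "lie_nilpotent (I + J)"
proof -
  show *: "lie_ideal (I + J)"
    using I J subspace_set_plus[of I J]
    by (auto simp: lie_ideal_def bracket_simps elim!: set_plus_elim intro!: set_plus_intro)
  show "lie_nilpotent (I + J)"
    unfolding nilpotent_ideal_iff[OF *]
    using I(2)[unfolded nilpotent_ideal_iff[OF I(1)]] J(2)[unfolded nilpotent_ideal_iff[OF J(1)]]
    by (auto elim!: set_plus_elim simp: bracket_simps intro!: subspace_add[OF adjacentD(1)])
qed

text \<open>A nilpotent ideal of maximal dimension contains every other one, since their sum is nilpotent. This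
shows that the greatest nilpotent ideal exists.\<close>
lemma
  shows lie_ideal_nilradical: "lie_ideal nilradical"
    and lie_nilpotent_nilradical: "lie_nilpotent nilradical"
    and nilradical_upper: "lie_ideal J \<Longrightarrow> lie_nilpotent J \<Longrightarrow> J \<subseteq> nilradical"
proof -
  let ?P = "\<lambda>I. lie_ideal I \<and> lie_nilpotent I"
  have "lie_ideal {0}" by (auto simp: lie_ideal_def bracket_simps)
  moreover have "lower_central {0} 0 = {0}" by simp
  then have "lie_nilpotent {0}" unfolding lie_nilpotent_def by blast
  ultimately have "?P {0}" by simp
  moreover have "\<forall>I. ?P I \<longrightarrow> dim I < Suc dimension"
    using dim_subset_UNIV le_imp_less_Suc by blast
  ultimately obtain I where I: "?P I" and max: "\<And>J. ?P J \<Longrightarrow> dim J \<le> dim I"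
    using ex_has_greatest_nat[of ?P "{0}" dim "Suc dimension"] by (metis order_less_imp_le)
  have upper: "J \<subseteq> I" if J: "?P J" for J
  proof -
    have K: "?P (I + J)" using nilpotent_ideal_sum I J by auto
    have 0: "0 \<in> I" "0 \<in> J" using I J lie_idealD(1) subspace_0 by auto
    have "I \<subseteq> I + J" using set_plus_intro[OF _ 0(2)] by force
    moreover have "J \<subseteq> I + J" using set_plus_intro[OF 0(1)] by force
    moreover have "I = I + J"
      using max[OF K] I K lie_idealD(1) by (intro subspace_dim_equal \<open>I \<subseteq> I + J\<close>) auto
    ultimately show ?thesis by simp
  qed
  have "nilradical = I"
    unfolding nilradical_def by (rule Greatest_equality) (use I upper in auto)
  then show "lie_ideal nilradical" "lie_nilpotent nilradical"
    "lie_ideal J \<Longrightarrow> lie_nilpotent J \<Longrightarrow> J \<subseteq> nilradical"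
    using I upper by auto
qed

text \<open>For a solvable Lie algebra, \<open>[A,A]\<close> acts as zero on each composition factor of the adjoint module, so it is a
nilpotent ideal. The sequence \<open>D\<close> is arbitrary so that the GD derived series, instead of the Lie derived
series, can be used for it.\<close>
lemma bracket_in_nilradical:
  assumes D: "D 0 = UNIV" "\<And>k. subspace (D k)" "D n = {0}"
    and DD: "\<And>k x y. x \<in> D k \<Longrightarrow> y \<in> D k \<Longrightarrow> bracket x y \<in> D (Suc k)"
  shows "bracket x y \<in> nilradical"
proof -
  let ?I = "span_prod bracket UNIV UNIV"
  have der: "f \<in> bracket ` D k" if "der (range bracket) k f" for k f
    using that
  proof induction
    case (der_comm k f g)
    then show ?case using DD by (auto simp: comm_bracket)
  next
    case (der_add k f g)
    then obtain x y where xy: "f = bracket x" "g = bracket y" "x \<in> D (Suc k)" "y \<in> D (Suc k)"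
      by auto
    have "(\<lambda>u. f u + g u) = bracket (x + y)" by (simp add: xy bracket_simps fun_eq_iff)
    then show ?case using xy subspace_add[OF D(2)] by auto
  qed (use D in auto)
  have I: "lie_ideal ?I"
    by (auto simp: lie_ideal_def subspace_span_prod intro: span_prodI)
  have "lie_nilpotent ?I"
    unfolding nilpotent_ideal_iff[OF I]
  proof (intro allI impI)
    fix W U z u assume adj: "adjacent (range bracket) W U" and z: "z \<in> ?I" and u: "u \<in> U"
    note W = adjacentD(1)[OF adj]
    have "comm (bracket x) (bracket y) u \<in> W" for x y
    proof (rule solvable_commutes[OF adj, where n = n])
      show "(\<lambda>u. f u + g u) \<in> range bracket" if fg: "f \<in> range bracket" "g \<in> range bracket" for f g
      proof -
        obtain x y where "f = bracket x" "g = bracket y" using fg by blast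
        then have "(\<lambda>u. f u + g u) = bracket (x + y)" by (simp add: bracket_simps fun_eq_iff)
        then show ?thesis by simp
      qed
      show "f u \<in> W" if "der (range bracket) n f" for f u
        using der[OF that] D(3) W by (auto simp: bracket_simps subspace_0)
    qed (use lin_bracket u in \<open>auto simp: comm_bracket\<close>)
    then have "bracket (bracket x y) u \<in> W" for x y by (simp add: comm_bracket)
    moreover have "subspace {z. bracket z u \<in> W}"
      using subspace_0[OF W] subspace_add[OF W] subspace_scale[OF W]
      by (auto simp: subspace_def bracket_simps)
    ultimately have "?I \<subseteq> {z. bracket z u \<in> W}" by (intro span_prod_minimal) auto
    then show "bracket z u \<in> W" using z by auto
  qed
  then have "?I \<subseteq> nilradical" by (rule nilradical_upper[OF I])
  then show ?thesis using span_prodI[of x UNIV y UNIV bracket] by auto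
qed

end

section \<open>GD algebras and their powers\<close>

locale fd_gd_algebra = gd_algebra scale circ bracket + fd_lie_algebra scale bracket Basis
  for scale :: "'k::field_char_0 \<Rightarrow> 'a::ab_group_add \<Rightarrow> 'a"
    and circ :: "'a \<Rightarrow> 'a \<Rightarrow> 'a" (infixl \<open>\<odot>\<close> 70)
    and bracket :: "'a \<Rightarrow> 'a \<Rightarrow> 'a" and Basis :: "'a set"
begin

lemma lin_circ: "lin (\<lambda>a. x \<odot> a)" and lin_circ_left: "lin (\<lambda>a. a \<odot> x)"
  using circ_bilinear by (auto simp: bilinear_prod_def)

lemmas circ_simps = lin_simps[OF lin_circ] lin_simps[OF lin_circ_left]

lemma subspace_gd_prod: "subspace (gd_prod U V)"
  unfolding gd_prod_def by (intro subspace_set_plus subspace_span_prod)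

lemma gd_prodI:
  assumes "u \<in> U" "v \<in> V"
  shows "u \<odot> v \<in> gd_prod U V" "bracket u v \<in> gd_prod U V"
proof -
  have "u \<odot> v + 0 \<in> gd_prod U V" "0 + bracket u v \<in> gd_prod U V"
    unfolding gd_prod_def
    by (intro set_plus_intro span_prodI assms subspace_0 subspace_span_prod)+
  then show "u \<odot> v \<in> gd_prod U V" "bracket u v \<in> gd_prod U V" by simp_all
qed

lemma gd_prod_minimal:
  assumes "subspace Z" "\<And>u v. u \<in> U \<Longrightarrow> v \<in> V \<Longrightarrow> u \<odot> v \<in> Z"
    "\<And>u v. u \<in> U \<Longrightarrow> v \<in> V \<Longrightarrow> bracket u v \<in> Z"
  shows "gd_prod U V \<subseteq> Z"
proof -
  have "span_prod circ U V \<subseteq> Z" "span_prod bracket U V \<subseteq> Z"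
    using assms by (intro span_prod_minimal; simp)+
  then show ?thesis
    unfolding gd_prod_def by (auto elim!: set_plus_elim intro!: subspace_add[OF assms(1)])
qed

lemma gd_prod_mono: "U \<subseteq> U' \<Longrightarrow> V \<subseteq> V' \<Longrightarrow> gd_prod U V \<subseteq> gd_prod U' V'"
  by (intro gd_prod_minimal subspace_gd_prod gd_prodI) auto

lemma subspace_gd_derived: "subspace (gd_derived n)"
  by (cases n) (auto simp: subspace_gd_prod)

lemma gd_derived_decreasing: "gd_derived (Suc n) \<subseteq> gd_derived n"
  by (induction n) (use gd_prod_mono in auto)

lemma gd_derived_le_1: "gd_derived (Suc n) \<subseteq> gd_derived 1"
proof (induction n)
  case (Suc n) then show ?case using gd_derived_decreasing[of "Suc n"] by blast
qed simp

abbreviation gd_power :: "'a set \<Rightarrow> nat \<Rightarrow> 'a set"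
  where "gd_power B n \<equiv> power_series gd_prod B n"

definition gd_subalgebra :: "'a set \<Rightarrow> bool"
  where "gd_subalgebra B \<longleftrightarrow> subspace B \<and> (\<forall>x\<in>B. \<forall>y\<in>B. x \<odot> y \<in> B \<and> bracket x y \<in> B)"

lemma gd_subalgebraD:
  assumes "gd_subalgebra B"
  shows "subspace B" "x \<in> B \<Longrightarrow> y \<in> B \<Longrightarrow> x \<odot> y \<in> B" "x \<in> B \<Longrightarrow> y \<in> B \<Longrightarrow> bracket x y \<in> B"
    "0 \<in> B" "gd_prod B B \<subseteq> B"
proof -
  show "gd_prod B B \<subseteq> B" using assms by (intro gd_prod_minimal) (auto simp: gd_subalgebra_def)
qed (use assms in \<open>auto simp: gd_subalgebra_def subspace_0\<close>)

lemma gd_subalgebra_derived: "gd_subalgebra (gd_derived n)"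
proof -
  have "gd_prod (gd_derived n) (gd_derived n) \<subseteq> gd_derived n"
    using gd_derived_decreasing by simp
  then show ?thesis using subspace_gd_derived gd_prodI by (auto simp: gd_subalgebra_def)
qed

lemma gd_power_step:
  assumes "1 \<le> k" "u \<in> gd_power B k" "x \<in> B"
  shows "x \<odot> u \<in> gd_power B (Suc k)" "u \<odot> x \<in> gd_power B (Suc k)" "bracket x u \<in> gd_power B (Suc k)"
proof -
  have sub: "gd_prod (gd_power B k) B \<subseteq> gd_power B (Suc k)" "gd_prod B (gd_power B k) \<subseteq> gd_power B (Suc k)"
    using power_series_mult[of gd_prod k 1 B] power_series_mult[of gd_prod 1 k B]
      subspace_gd_prod assms(1) by simp_all
  show "x \<odot> u \<in> gd_power B (Suc k)" "u \<odot> x \<in> gd_power B (Suc k)" "bracket x u \<in> gd_power B (Suc k)"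
    by (rule sub[THEN subsetD], rule gd_prodI, fact, fact)+
qed

lemma subspace_gd_power: "subspace B \<Longrightarrow> subspace (gd_power B n)"
  by (intro subspace_power_series subspace_gd_prod)

lemma gd_power_le:
  assumes B: "gd_subalgebra B"
  shows "gd_power B n \<subseteq> B"
proof (induction n rule: less_induct)
  case (less n)
  show ?case
  proof (cases "n \<ge> 2")
    case True
    show ?thesis
    proof (rule power_series_minimal[OF True gd_subalgebraD(1)[OF B]])
      fix i assume "1 \<le> i" "i < n"
      then have "gd_prod (gd_power B i) (gd_power B (n - i)) \<subseteq> gd_prod B B"
        by (intro gd_prod_mono less) auto
      then show "gd_prod (gd_power B i) (gd_power B (n - i)) \<subseteq> B" using gd_subalgebraD(5)[OF B] by blast
    qed
  next
    case False
    then have "n = 0 \<or> n = Suc 0" by auto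
    then show ?thesis by auto
  qed
qed

lemma gd_power_decreasing:
  assumes B: "gd_subalgebra B"
  shows "gd_power B (Suc n) \<subseteq> gd_power B n"
proof (induction n rule: less_induct)
  case (less n)
  show ?case
  proof (cases "n \<ge> 2")
    case True
    show ?thesis
    proof (rule power_series_minimal)
      fix i assume i: "1 \<le> i" "i < Suc n"
      show "gd_prod (gd_power B i) (gd_power B (Suc n - i)) \<subseteq> gd_power B n"
      proof (cases "i = n")
        case False
        then have "gd_power B (Suc n - i) \<subseteq> gd_power B (n - i)"
          using less[of "n - i"] i by (simp add: Suc_diff_le)
        then have "gd_prod (gd_power B i) (gd_power B (Suc n - i)) \<subseteq> gd_prod (gd_power B i) (gd_power B (n - i))"
          by (intro gd_prod_mono) auto
        also have "\<dots> \<subseteq> gd_power B n"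
          using i False by (intro power_series_upper subspace_gd_prod) auto
        finally show ?thesis .
      next
        case True
        then have "gd_power B i \<subseteq> gd_power B (n - 1)"
          using less[of "n - 1"] \<open>n \<ge> 2\<close> by simp
        then have "gd_prod (gd_power B i) (gd_power B (Suc n - i)) \<subseteq> gd_prod (gd_power B (n - 1)) (gd_power B 1)"
          using True by (intro gd_prod_mono) auto
        also have "\<dots> \<subseteq> gd_power B n"
          using power_series_mult[of gd_prod "n - 1" 1 B] subspace_gd_prod \<open>n \<ge> 2\<close> by simp
        finally show ?thesis .
      qed
    qed (use True subspace_gd_power gd_subalgebraD(1)[OF B] in auto)
  next
    case False
    then have "n = 0 \<or> n = Suc 0" by auto
    then show ?thesis using gd_power_le[OF B, of "Suc n"] by auto
  qed
qed

section \<open>The multiplication algebra and the ideal generated by the operators R ad\<close>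

lemma fun_subspaceI:
  assumes "(\<lambda>x. 0) \<in> F" "\<And>f g. f \<in> F \<Longrightarrow> g \<in> F \<Longrightarrow> (\<lambda>x. f x + g x) \<in> F"
    "\<And>c f. f \<in> F \<Longrightarrow> (\<lambda>x. scale c (f x)) \<in> F"
  shows "fun_space.subspace F"
  using assms by (auto simp: fun_space.subspace_def zero_fun_def plus_fun_def)

lemma End_onD:
  assumes "f \<in> End_on B"
  shows "x \<in> B \<Longrightarrow> f x \<in> B" "x \<notin> B \<Longrightarrow> f x = 0"
    "x \<in> B \<Longrightarrow> y \<in> B \<Longrightarrow> f (x + y) = f x + f y" "x \<in> B \<Longrightarrow> f (scale c x) = scale c (f x)"
    "0 \<in> B \<Longrightarrow> f 0 = 0"
proof -
  show *: "x \<in> B \<Longrightarrow> f x \<in> B" "x \<notin> B \<Longrightarrow> f x = 0"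
    "x \<in> B \<Longrightarrow> y \<in> B \<Longrightarrow> f (x + y) = f x + f y" "x \<in> B \<Longrightarrow> f (scale c x) = scale c (f x)" for x y c
    using assms by (auto simp: End_on_def)
  show "f 0 = 0" if "0 \<in> B" using *(4)[OF that, of 0] by simp
qed

text \<open>With \<open>X = Y\<close> these are the endomorphisms preserving given subspaces; with \<open>X i\<close> and \<open>Y i\<close> consecutive powers of
\<open>B\<close> they are those raising the filtration degree.\<close>
lemma End_on_filtered_subalgebra:
  assumes B: "subspace B"
    and X: "\<And>i. X i \<subseteq> B" and Y: "\<And>i. subspace (Y i)" and YX: "\<And>i. Y i \<subseteq> X i"
  shows "nonunital_subalgebra B {f \<in> End_on B. \<forall>i. \<forall>u\<in>X i. f u \<in> Y i}"
  unfolding nonunital_subalgebra_def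
proof (intro conjI ballI)
  note sB = subspace_0[OF B] subspace_add[OF B] subspace_scale[OF B]
  note sY = subspace_0[OF Y] subspace_add[OF Y] subspace_scale[OF Y]
  show "fun_space.subspace {f \<in> End_on B. \<forall>i. \<forall>u\<in>X i. f u \<in> Y i}"
    by (rule fun_subspaceI)
      (auto simp: End_on_def sB sY scale_right_distrib mult.commute ac_simps)
  fix f g assume "f \<in> {f \<in> End_on B. \<forall>i. \<forall>u\<in>X i. f u \<in> Y i}"
    "g \<in> {f \<in> End_on B. \<forall>i. \<forall>u\<in>X i. f u \<in> Y i}"
  then have f: "f \<in> End_on B" "\<And>i u. u \<in> X i \<Longrightarrow> f u \<in> Y i"
    and g: "g \<in> End_on B" "\<And>i u. u \<in> X i \<Longrightarrow> g u \<in> Y i" by auto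
  have "f \<circ> g \<in> End_on B"
    using End_onD[OF f(1)] End_onD[OF g(1)] sB by (auto simp: End_on_def)
  then show "f \<circ> g \<in> {f \<in> End_on B. \<forall>i. \<forall>u\<in>X i. f u \<in> Y i}"
    using f(2) g(2) YX by auto blast
qed auto

lemma mult_algebra_filtered:
  assumes B: "gd_subalgebra B"
    and X: "\<And>i. X i \<subseteq> B" and Y: "\<And>i. subspace (Y i)" and YX: "\<And>i. Y i \<subseteq> X i"
    and step: "\<And>i x u. x \<in> B \<Longrightarrow> u \<in> X i \<Longrightarrow> x \<odot> u \<in> Y i \<and> u \<odot> x \<in> Y i \<and> bracket x u \<in> Y i"
    and f: "f \<in> mult_algebra B"
  shows "f \<in> End_on B" "u \<in> X i \<Longrightarrow> f u \<in> Y i"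
proof -
  let ?N = "{f \<in> End_on B. \<forall>i. \<forall>u\<in>X i. f u \<in> Y i}"
  note gd_subalgebraD[OF B]
  have XB: "u \<in> B" if "u \<in> X i" for u i using X that by auto
  have "mult_algebra B \<subseteq> ?N"
    unfolding mult_algebra_def
  proof (rule hull_minimal)
    show "(\<Union>x\<in>B. {L_on B x, R_on B x, ad_on B x}) \<subseteq> ?N"
      using step gd_subalgebraD[OF B]
      by (auto simp: End_on_def L_on_def R_on_def ad_on_def circ_simps bracket_simps
          subspace_add subspace_scale XB)
    show "nonunital_subalgebra B ?N"
      by (rule End_on_filtered_subalgebra) (use gd_subalgebraD[OF B] X Y YX in auto)
  qed
  then show "f \<in> End_on B" "u \<in> X i \<Longrightarrow> f u \<in> Y i" using f by auto
qed

lemma mult_algebra_gens: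
  assumes "x \<in> B"
  shows "L_on B x \<in> mult_algebra B" "R_on B x \<in> mult_algebra B" "ad_on B x \<in> mult_algebra B"
  using assms unfolding mult_algebra_def by (auto intro!: hull_inc)

lemma mult_algebra_End:
  assumes B: "gd_subalgebra B"
  shows "mult_algebra B \<subseteq> End_on B"
  using mult_algebra_filtered(1)[OF B, where X = "\<lambda>i::unit. B" and Y = "\<lambda>i. B"] gd_subalgebraD[OF B]
  by auto

lemma mult_algebra_closed:
  shows "fun_space.subspace (mult_algebra B)"
    and "f \<in> mult_algebra B \<Longrightarrow> g \<in> mult_algebra B \<Longrightarrow> f \<circ> g \<in> mult_algebra B"
  unfolding mult_algebra_def hull_def
  by (auto simp: nonunital_subalgebra_def intro!: fun_space.subspace_Inter)

lemma R_ad_ideal_closed: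
  "f \<in> mult_algebra B \<Longrightarrow> g \<in> R_ad_ideal B \<Longrightarrow> f \<circ> g \<in> R_ad_ideal B"
  unfolding R_ad_ideal_def hull_def by (auto simp: two_sided_ideal_def)

lemma R_ad_ideal_subset: "R_ad_ideal B \<subseteq> mult_algebra B"
  unfolding R_ad_ideal_def
  by (rule hull_minimal)
    (auto simp: two_sided_ideal_def mult_algebra_closed mult_algebra_gens)

lemma R_ad_in_ideal: "x \<in> B \<Longrightarrow> y \<in> B \<Longrightarrow> R_on B x \<circ> ad_on B y \<in> R_ad_ideal B"
  unfolding R_ad_ideal_def by (rule hull_inc) blast

section \<open>Multiplication operators on composition factors\<close>

text \<open>The generators of the multiplication algebra of \<open>B\<close>, as linear operators on the whole space. They agree on
\<open>B\<close> with \<open>L_on\<close>, \<open>R_on\<close> and \<open>ad_on\<close>, which are 0 outside \<open>B\<close> and in general not linear on the whole space.\<close>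
definition gd_ops :: "'a set \<Rightarrow> ('a \<Rightarrow> 'a) set"
  where "gd_ops B = (\<Union>x\<in>B. {\<lambda>a. x \<odot> a, \<lambda>a. a \<odot> x, bracket x})"

lemma gd_opsE:
  assumes "g \<in> gd_ops B"
  obtains x where "x \<in> B" "g = (\<lambda>a. x \<odot> a)" | x where "x \<in> B" "g = (\<lambda>a. a \<odot> x)"
    | x where "x \<in> B" "g = bracket x"
  using assms by (auto simp: gd_ops_def)

lemma gd_opsI:
  assumes "x \<in> B"
  shows "(\<lambda>a. x \<odot> a) \<in> gd_ops B" "(\<lambda>a. a \<odot> x) \<in> gd_ops B" "bracket x \<in> gd_ops B"
  using assms by (auto simp: gd_ops_def)

lemma lin_gd_ops: "g \<in> gd_ops B \<Longrightarrow> lin g"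
  by (elim gd_opsE) (simp_all add: lin_circ lin_circ_left lin_bracket)

lemma assoc_power_End:
  assumes J: "J \<subseteq> End_on B" and B: "subspace B"
  shows "assoc_power J n \<subseteq> End_on B"
proof (induction n)
  case (Suc n)
  have "nonunital_subalgebra B {f \<in> End_on B. \<forall>i::unit. \<forall>u\<in>B. f u \<in> B}"
    by (rule End_on_filtered_subalgebra) (use B in auto)
  moreover have "{f \<in> End_on B. \<forall>i::unit. \<forall>u\<in>B. f u \<in> B} = End_on B"
    by (auto simp: End_on_def)
  ultimately have N: "nonunital_subalgebra B (End_on B)" by simp
  then have "fun_space.span {f \<circ> g | f g. f \<in> J \<and> g \<in> assoc_power J n} \<subseteq> End_on B"
    using J Suc by (intro fun_space.span_minimal) (auto simp: nonunital_subalgebra_def)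
  then show ?case by simp
qed (use J in simp)

text \<open>The ideal \<open>J\<close> generated by all \<open>R\<^sub>x ad\<^sub>y\<close> is nilpotent and absorbs multiplication operators from the left,
which is what \<open>adjacent_killed\<close> asks for.\<close>
lemma R_ad_zero_on_factor:
  assumes B: "gd_subalgebra B" and nilp: "assoc_nilpotent (R_ad_ideal B)"
    and adj: "adjacent (gd_ops B) W U" and UB: "U \<subseteq> B"
    and x: "x \<in> B" and y: "y \<in> B" and u: "u \<in> U"
  shows "bracket y u \<odot> x \<in> W"
proof -
  note W = adjacentD(1)[OF adj] and U = adjacentD(2)[OF adj] and WU = adjacentD(3)[OF adj]
  have JE: "R_ad_ideal B \<subseteq> End_on B" using R_ad_ideal_subset mult_algebra_End[OF B] by blast
  have inv: "f u \<in> X" if X: "X = U \<or> X = W" and f: "f \<in> mult_algebra B" and u: "u \<in> X" for f u X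
  proof (rule mult_algebra_filtered(2)[OF B, where X = "\<lambda>i::unit. X" and Y = "\<lambda>i. X" and f = f and u = u])
    show "X \<subseteq> B" using X UB WU by auto
    show "subspace X" using X U W by auto
    show "x \<odot> u \<in> X \<and> u \<odot> x \<in> X \<and> bracket x u \<in> X" if "x \<in> B" "u \<in> X" for x u
      using X adjacentD(7)[OF adj gd_opsI(1)] adjacentD(7)[OF adj gd_opsI(2)]
        adjacentD(7)[OF adj gd_opsI(3)] adjacentD(8)[OF adj gd_opsI(1)]
        adjacentD(8)[OF adj gd_opsI(2)] adjacentD(8)[OF adj gd_opsI(3)] that by auto
  qed (use f u in auto)
  obtain n where n: "assoc_power (R_ad_ideal B) n = {0}" using nilp by (auto simp: assoc_nilpotent_def)
  have le: "descend (R_ad_ideal B) U (Suc k) \<subseteq> span {f u | f u. f \<in> assoc_power (R_ad_ideal B) k \<and> u \<in> U}" for k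
  proof (induction k)
    case (Suc k)
    let ?Z = "span {f u | f u. f \<in> assoc_power (R_ad_ideal B) (Suc k) \<and> u \<in> U}"
    have "h v \<in> ?Z" if h: "h \<in> R_ad_ideal B" and v: "v \<in> descend (R_ad_ideal B) U (Suc k)" for h v
    proof -
      have hE: "h \<in> End_on B" using h JE by auto
      note h' = End_onD[OF hE]
      have "subspace {v \<in> B. h v \<in> ?Z}"
        using h' gd_subalgebraD[OF B]
        by (auto simp: subspace_def intro: span_zero span_add span_scale)
      moreover have "f u \<in> B \<and> h (f u) \<in> ?Z" if f: "f \<in> assoc_power (R_ad_ideal B) k" and u: "u \<in> U" for f u
      proof
        show "f u \<in> B"
          using assoc_power_End[OF JE gd_subalgebraD(1)[OF B], of k] f u UB End_onD(1) by blast
        have "h \<circ> f \<in> assoc_power (R_ad_ideal B) (Suc k)"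
          using h f by (auto intro!: fun_space.span_base)
        then show "h (f u) \<in> ?Z" using u by (intro span_base CollectI exI[of _ "h \<circ> f"] exI[of _ u]) (simp del: assoc_power.simps)
      qed
      ultimately have "span {f u | f u. f \<in> assoc_power (R_ad_ideal B) k \<and> u \<in> U} \<subseteq> {v \<in> B. h v \<in> ?Z}"
        by (intro span_minimal) auto
      then show ?thesis using Suc v by blast
    qed
    then have "{h v | h v. h \<in> R_ad_ideal B \<and> v \<in> descend (R_ad_ideal B) U (Suc k)} \<subseteq> ?Z" by blast
    then show ?case unfolding descend.simps(2)[of _ _ "Suc k"] by (intro span_minimal subspace_span)
  qed simp
  have "(R_on B x \<circ> ad_on B y) u \<in> W"
  proof (rule adjacent_killed[OF adj, where H = "R_ad_ideal B" and n = "Suc n" and u = u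
        and h = "R_on B x \<circ> ad_on B y"])
    have "{f u | f u. f \<in> assoc_power (R_ad_ideal B) n \<and> u \<in> U} \<subseteq> W"
      using subspace_0[OF W] by (auto simp: n)
    then show "descend (R_ad_ideal B) U (Suc n) \<subseteq> W"
      by (rule subset_trans[OF le span_minimal[OF _ W]])
  next
    fix g h u assume g: "g \<in> gd_ops B" and h: "h \<in> R_ad_ideal B" and u: "u \<in> U"
    have hB: "h u \<in> B" using h u UB JE End_onD(1) by blast
    obtain g' where g': "g' \<in> mult_algebra B" "g' (h u) = g (h u)"
      using g
    proof (cases rule: gd_opsE)
      case (1 x)
      then show ?thesis using that[OF mult_algebra_gens(1), of x] hB by (simp add: L_on_def)
    next
      case (2 x)
      then show ?thesis using that[OF mult_algebra_gens(2), of x] hB by (simp add: R_on_def)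
    next
      case (3 x)
      then show ?thesis using that[OF mult_algebra_gens(3), of x] hB by (simp add: ad_on_def)
    qed
    have "g' \<circ> h \<in> R_ad_ideal B" by (rule R_ad_ideal_closed[OF g'(1) h])
    then have "(g' \<circ> h) u \<in> span ({h u | h u. h \<in> R_ad_ideal B \<and> u \<in> U} \<union> W)"
      using u by (intro span_base) blast
    then show "g (h u) \<in> span ({h u | h u. h \<in> R_ad_ideal B \<and> u \<in> U} \<union> W)"
      using g'(2) by simp
  next
    fix h u assume h: "h \<in> R_ad_ideal B"
    show "u \<in> U \<Longrightarrow> h u \<in> U" "u \<in> W \<Longrightarrow> h u \<in> W"
      using inv[of U h u] inv[of W h u] h R_ad_ideal_subset by blast+
    show "h (u + v) = h u + h v" if "u \<in> U" "v \<in> U" for v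
      using End_onD(3)[of h B u v] h JE that UB by blast
    show "h (scale c u) = scale c (h u)" if "u \<in> U" for c
      using End_onD(4)[of h B u c] h JE that UB by blast
  qed (use lin_gd_ops R_ad_in_ideal[OF x y] u in auto)
  moreover have "bracket y u \<in> B" "u \<in> B" using u UB gd_subalgebraD(3)[OF B y] by auto
  ultimately show ?thesis by (simp add: R_on_def ad_on_def)
qed

lemma funpow_circ:
  assumes "x \<in> B" "u \<in> B"
  shows "((\<lambda>a. x \<odot> a) ^^ n) u \<in> power_series (span_prod circ) B (Suc n)"
    "((\<lambda>a. a \<odot> x) ^^ n) u \<in> power_series (span_prod circ) B (Suc n)"
proof -
  let ?ps = "power_series (span_prod circ) B"
  have 1: "span_prod circ B (?ps (Suc n)) \<subseteq> ?ps (Suc (Suc n))"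
    "span_prod circ (?ps (Suc n)) B \<subseteq> ?ps (Suc (Suc n))" for n
    using power_series_mult[of "span_prod circ" "Suc n" 1 B]
      power_series_mult[of "span_prod circ" 1 "Suc n" B] subspace_span_prod by simp_all
  show "((\<lambda>a. x \<odot> a) ^^ n) u \<in> ?ps (Suc n)"
  proof (induction n)
    case (Suc n)
    then show ?case using 1(1)[of n] span_prodI[OF assms(1) Suc, of circ] by (auto simp del: power_series.simps)
  qed (use assms in simp)
  show "((\<lambda>a. a \<odot> x) ^^ n) u \<in> ?ps (Suc n)"
  proof (induction n)
    case (Suc n)
    then show ?case using 1(2)[of n] span_prodI[OF Suc assms(1), of circ] by (auto simp del: power_series.simps)
  qed (use assms in simp)
qed

lemma nilpotent_circ:
  assumes "novikov_nilpotent B" "x \<in> B" "0 \<in> W" "U \<subseteq> B"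
  shows "\<exists>n. \<forall>u\<in>U. ((\<lambda>a. x \<odot> a) ^^ n) u \<in> W" "\<exists>n. \<forall>u\<in>U. ((\<lambda>a. a \<odot> x) ^^ n) u \<in> W"
proof -
  obtain N where N: "N \<ge> 1" "power_series (span_prod circ) B N = {0}"
    using assms(1) by (auto simp: novikov_nilpotent_def)
  then have "power_series (span_prod circ) B (Suc (N - 1)) = {0}" by simp
  then have "((\<lambda>a. x \<odot> a) ^^ (N - 1)) u = 0" "((\<lambda>a. a \<odot> x) ^^ (N - 1)) u = 0" if "u \<in> B" for u
    using funpow_circ[OF assms(2) that, of "N - 1"] by auto
  then show "\<exists>n. \<forall>u\<in>U. ((\<lambda>a. x \<odot> a) ^^ n) u \<in> W" "\<exists>n. \<forall>u\<in>U. ((\<lambda>a. a \<odot> x) ^^ n) u \<in> W"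
    using assms(3,4) by (metis subsetD)+
qed

text \<open>The operators \<open>R\<^sub>z\<close> commute by right commutativity. Suppose they all annihilate \<open>u\<close>. They annihilate
\<open>x \<odot> u\<close> because left-symmetry writes \<open>(x \<odot> u) \<odot> z\<close> as \<open>x \<odot> (u \<odot> z) + (u \<odot> x) \<odot> z - u \<odot> (x \<odot> z)\<close>, and
they annihilate \<open>[x,u]\<close> because \<open>R\<^sub>z ad\<^sub>x = 0\<close>. So their common kernel is a submodule.\<close>
lemma R_zero_on_factor:
  assumes B: "gd_subalgebra B" and nov: "novikov_nilpotent B"
    and nilp: "assoc_nilpotent (R_ad_ideal B)"
    and adj: "adjacent (gd_ops B) W U" and UB: "U \<subseteq> B"
    and x: "x \<in> B" and u: "u \<in> U"
  shows "u \<odot> x \<in> W"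
proof (rule adjacent_kernel[OF adj, where H = "{\<lambda>a. a \<odot> z | z. z \<in> B}" and h = "\<lambda>a. a \<odot> x" and u = u])
  note W = adjacentD(1)[OF adj] and U = adjacentD(2)[OF adj]
  show "\<exists>n. \<forall>u\<in>U. (h ^^ n) u \<in> W" if "h \<in> {\<lambda>a. a \<odot> z | z. z \<in> B}" for h
    using that nilpotent_circ(2)[OF nov _ subspace_0[OF W] UB] by auto
  show "comm h h' u \<in> W" if "h \<in> {\<lambda>a. a \<odot> z | z. z \<in> B}" "h' \<in> {\<lambda>a. a \<odot> z | z. z \<in> B}" for h h' u
    using that right_commutative[of u] subspace_0[OF W] by (auto simp: comm_def)
  fix g h u assume g: "g \<in> gd_ops B" and h: "h \<in> {\<lambda>a. a \<odot> z | z. z \<in> B}" and u: "u \<in> U"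
    and killed: "\<And>h. h \<in> {\<lambda>a. a \<odot> z | z. z \<in> B} \<Longrightarrow> h u \<in> W"
  obtain z where z: "z \<in> B" "h = (\<lambda>a. a \<odot> z)" using h by auto
  have R0: "u \<odot> y \<in> W" if "y \<in> B" for y using killed[of "\<lambda>a. a \<odot> y"] that by auto
  show "h (g u) \<in> W"
    using g
  proof (cases rule: gd_opsE)
    case (1 x)
    have "(x \<odot> u) \<odot> z = x \<odot> (u \<odot> z) + (u \<odot> x) \<odot> z - u \<odot> (x \<odot> z)"
      using left_symmetric[of x u z] by (simp add: algebra_simps)
    also have "\<dots> \<in> W"
      using adjacentD(8)[OF adj gd_opsI(1)[OF 1(1)] R0[OF z(1)]]
        adjacentD(8)[OF adj gd_opsI(2)[OF z(1)] R0[OF 1(1)]]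
        R0[OF gd_subalgebraD(2)[OF B 1(1) z(1)]]
      by (intro subspace_diff[OF W] subspace_add[OF W])
    finally show ?thesis by (simp add: 1 z)
  next
    case (2 x)
    have "(u \<odot> x) \<odot> z \<in> W" using adjacentD(8)[OF adj gd_opsI(2)[OF z(1)] R0[OF 2(1)]] .
    then show ?thesis by (simp add: 2 z)
  next
    case (3 x)
    then show ?thesis using R_ad_zero_on_factor[OF B nilp adj UB z(1) _ u] by (simp add: z)
  qed
qed (use x u lin_gd_ops lin_circ_left adjacentD(7,8)[OF adj gd_opsI(2)] in auto)

text \<open>The commutator of \<open>L\<^sub>x + ad\<^sub>y\<close> and \<open>L\<^bsub>x'\<^esub> + ad\<^bsub>y'\<^esub>\<close> is an operator of the same shape, up to terms that end with a
right multiplication. The new arguments are sums of products and brackets of the old ones.\<close>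
lemma gd_commutator:
  "x \<odot> (x' \<odot> u + bracket y' u) + bracket y (x' \<odot> u + bracket y' u)
      - (x' \<odot> (x \<odot> u + bracket y u) + bracket y' (x \<odot> u + bracket y u))
    = (x \<odot> x' - x' \<odot> x - bracket x' y + bracket x y') \<odot> u
      + bracket (x \<odot> y' - x' \<odot> y + bracket y y') u
      + (bracket x' u \<odot> y - bracket x u \<odot> y')"
proof -
  have 1: "bracket y (x' \<odot> u) = x' \<odot> bracket y u - bracket (x' \<odot> y) u - bracket x' y \<odot> u + bracket x' u \<odot> y"
    for y x'
    using gd_compatible[of y x' u] unfolding bracket_anti[of u "x' \<odot> y"]
    by (simp add: algebra_simps)
  have 2: "x \<odot> (x' \<odot> u) - x' \<odot> (x \<odot> u) = (x \<odot> x') \<odot> u - (x' \<odot> x) \<odot> u"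
    using left_symmetric[of x x' u] by (simp add: algebra_simps)
  have 3: "bracket y (bracket y' u) - bracket y' (bracket y u) = bracket (bracket y y') u"
    using fun_cong[OF comm_bracket[of y y'], of u] by (simp add: comm_def)
  have "x \<odot> (x' \<odot> u + bracket y' u) + bracket y (x' \<odot> u + bracket y' u)
      - (x' \<odot> (x \<odot> u + bracket y u) + bracket y' (x \<odot> u + bracket y u))
    = (x \<odot> (x' \<odot> u) - x' \<odot> (x \<odot> u)) + (bracket y (bracket y' u) - bracket y' (bracket y u))
      + (bracket y (x' \<odot> u) - x' \<odot> bracket y u) - (bracket y' (x \<odot> u) - x \<odot> bracket y' u)"
    by (simp add: circ_simps bracket_simps)
  then show ?thesis
    unfolding 2 3 unfolding 1 by (simp add: circ_simps bracket_simps)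
qed

text \<open>Modulo \<open>W\<close>, the commutator identity turns a chain \<open>D\<close> with \<open>D k \<odot> D k + [D k, D k] \<subseteq> D (k + 1)\<close> into a chain of sets
\<open>F k\<close> of operators with \<open>[F k, F k] \<subseteq> F (k + 1)\<close>. Here \<open>F k\<close> contains all operators congruent to some
\<open>L\<^sub>x + ad\<^sub>y\<close> with \<open>x, y \<in> D k\<close>: the operators \<open>L\<^sub>x + ad\<^sub>y\<close> themselves are closed under commutators only modulo \<open>W\<close>.
As the right multiplications act as zero, the factor stays irreducible under \<open>F 0\<close>.\<close>
lemma L_ad_commute_on_factor:
  assumes D: "\<And>k. subspace (D k)" "\<And>k. gd_prod (D k) (D k) \<subseteq> D (Suc k)" "\<And>k. D (Suc k) \<subseteq> D k"
    "D n = {0}"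
    and adj: "adjacent (gd_ops (D 0)) W U"
    and R0: "\<And>x u. x \<in> D 0 \<Longrightarrow> u \<in> U \<Longrightarrow> u \<odot> x \<in> W"
    and D0_elements: "x \<in> D 0" "y \<in> D 0" "x' \<in> D 0" "y' \<in> D 0"
    and u: "u \<in> U"
  shows "comm (\<lambda>u. x \<odot> u + bracket y u) (\<lambda>u. x' \<odot> u + bracket y' u) u \<in> W"
proof -
  note W = adjacentD(1)[OF adj] and U = adjacentD(2)[OF adj] and WU = adjacentD(3)[OF adj]
  note W_simps = subspace_0[OF W] subspace_add[OF W] subspace_scale[OF W] subspace_diff[OF W]
  note opU = adjacentD(7)[OF adj gd_opsI(1)] adjacentD(7)[OF adj gd_opsI(2)] adjacentD(7)[OF adj gd_opsI(3)]
  note opW = adjacentD(8)[OF adj gd_opsI(1)] adjacentD(8)[OF adj gd_opsI(2)] adjacentD(8)[OF adj gd_opsI(3)]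
  define F where "F k = {f. lin f \<and> (\<forall>u\<in>U. f u \<in> U) \<and> (\<forall>u\<in>W. f u \<in> W) \<and>
    (\<exists>x\<in>D k. \<exists>y\<in>D k. \<forall>u\<in>U. f u - (x \<odot> u + bracket y u) \<in> W)}" for k
  have FI: "f \<in> F k" if "lin f" "\<And>u. u \<in> U \<Longrightarrow> f u \<in> U" "\<And>u. u \<in> W \<Longrightarrow> f u \<in> W" "x \<in> D k" "y \<in> D k"
    "\<And>u. u \<in> U \<Longrightarrow> f u - (x \<odot> u + bracket y u) \<in> W" for f k x y
    using that unfolding F_def by blast
  have FE: "\<exists>x\<in>D k. \<exists>y\<in>D k. \<forall>u\<in>U. f u - (x \<odot> u + bracket y u) \<in> W"
    and Flin: "lin f" and FU: "u \<in> U \<Longrightarrow> f u \<in> U" and FW: "u \<in> W \<Longrightarrow> f u \<in> W"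
    if "f \<in> F k" for f k u
    using that unfolding F_def by blast+
  have D0: "D k \<subseteq> D 0" for k
    by (induction k) (use D(3) in blast)+
  have F_mono: "F (Suc k) \<subseteq> F k" for k
    using D(3)[of k] unfolding F_def by blast
  have F_add: "(\<lambda>u. f u + g u) \<in> F k" if fg: "f \<in> F k" "g \<in> F k" for f g k
  proof -
    obtain x y where xy: "x \<in> D k" "y \<in> D k" "\<And>u. u \<in> U \<Longrightarrow> f u - (x \<odot> u + bracket y u) \<in> W"
      using FE[OF fg(1)] by auto
    obtain x' y' where xy': "x' \<in> D k" "y' \<in> D k" "\<And>u. u \<in> U \<Longrightarrow> g u - (x' \<odot> u + bracket y' u) \<in> W"
      using FE[OF fg(2)] by auto
    show ?thesis
    proof (rule FI)
      show "x + x' \<in> D k" "y + y' \<in> D k" using xy xy' subspace_add[OF D(1)] by auto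
      fix u assume u: "u \<in> U"
      have "f u + g u - ((x + x') \<odot> u + bracket (y + y') u)
        = (f u - (x \<odot> u + bracket y u)) + (g u - (x' \<odot> u + bracket y' u))"
        by (simp add: circ_simps bracket_simps)
      also have "\<dots> \<in> W" using xy(3)[OF u] xy'(3)[OF u] by (rule subspace_add[OF W])
      finally show "f u + g u - ((x + x') \<odot> u + bracket (y + y') u) \<in> W" .
    qed (use Flin[OF fg(1)] Flin[OF fg(2)] FU[OF fg(1)] FU[OF fg(2)] FW[OF fg(1)] FW[OF fg(2)]
        subspace_add[OF U] W_simps lin_plus in auto)
  qed
  have F_comm: "comm f g \<in> F (Suc k)" if fg: "f \<in> F k" "g \<in> F k" for f g k
  proof -
    obtain x y where xy: "x \<in> D k" "y \<in> D k" "\<And>u. u \<in> U \<Longrightarrow> f u - (x \<odot> u + bracket y u) \<in> W"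
      using FE[OF fg(1)] by auto
    obtain x' y' where xy': "x' \<in> D k" "y' \<in> D k" "\<And>u. u \<in> U \<Longrightarrow> g u - (x' \<odot> u + bracket y' u) \<in> W"
      using FE[OF fg(2)] by auto
    have Suc: "a \<odot> b \<in> D (Suc k)" "bracket a b \<in> D (Suc k)" if "a \<in> D k" "b \<in> D k" for a b
      using gd_prodI[OF that] D(2) by auto
    have compose: "f (g u) - (x \<odot> (x' \<odot> u + bracket y' u) + bracket y (x' \<odot> u + bracket y' u)) \<in> W"
      if "g \<in> F k" "x \<in> D k" "y \<in> D k" "u \<in> U"
        "\<And>u. u \<in> U \<Longrightarrow> f u - (x \<odot> u + bracket y u) \<in> W"
        "\<And>u. u \<in> U \<Longrightarrow> g u - (x' \<odot> u + bracket y' u) \<in> W"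
      for f g x y x' y' u
    proof -
      have "f (g u) - (x \<odot> (x' \<odot> u + bracket y' u) + bracket y (x' \<odot> u + bracket y' u))
        = (f (g u) - (x \<odot> g u + bracket y (g u)))
          + (x \<odot> (g u - (x' \<odot> u + bracket y' u)) + bracket y (g u - (x' \<odot> u + bracket y' u)))"
        by (simp add: circ_simps bracket_simps)
      also have "\<dots> \<in> W"
      proof (intro subspace_add[OF W])
        show "f (g u) - (x \<odot> g u + bracket y (g u)) \<in> W"
          by (rule that(5)[OF FU[OF that(1,4)]])
        show "x \<odot> (g u - (x' \<odot> u + bracket y' u)) \<in> W"
          by (rule opW(1)[OF subsetD[OF D0 that(2)] that(6)[OF that(4)]])
        show "bracket y (g u - (x' \<odot> u + bracket y' u)) \<in> W"
          by (rule opW(3)[OF subsetD[OF D0 that(3)] that(6)[OF that(4)]])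
      qed
      finally show ?thesis .
    qed
    \<comment> \<open>The arguments of the commutator given by \<open>gd_commutator\<close>.\<close>
    let ?X = "x \<odot> x' - x' \<odot> x - bracket x' y + bracket x y'"
    let ?Y = "x \<odot> y' - x' \<odot> y + bracket y y'"
    show ?thesis
    proof (rule FI)
      show "?X \<in> D (Suc k)" "?Y \<in> D (Suc k)"
        using xy xy' by (intro subspace_add[OF D(1)] subspace_diff[OF D(1)] Suc; simp)+
      fix u assume u: "u \<in> U"
      let ?fg = "x \<odot> (x' \<odot> u + bracket y' u) + bracket y (x' \<odot> u + bracket y' u)"
      let ?gf = "x' \<odot> (x \<odot> u + bracket y u) + bracket y' (x \<odot> u + bracket y u)"
      have "x \<in> D 0" "y \<in> D 0" "x' \<in> D 0" "y' \<in> D 0" using xy xy' D0[of k] by auto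
      then have "bracket x' u \<odot> y - bracket x u \<odot> y' \<in> W"
        by (intro subspace_diff[OF W] R0 opU(3) u)
      moreover have "f (g u) - ?fg \<in> W" "g (f u) - ?gf \<in> W"
        using compose[OF fg(2) xy(1,2) u xy(3) xy'(3)] compose[OF fg(1) xy'(1,2) u xy'(3) xy(3)] by auto
      ultimately have "(f (g u) - ?fg) - (g (f u) - ?gf) + (bracket x' u \<odot> y - bracket x u \<odot> y') \<in> W"
        by (rule subspace_add[OF W subspace_diff[OF W], rotated 2])
      also have "(f (g u) - ?fg) - (g (f u) - ?gf) + (bracket x' u \<odot> y - bracket x u \<odot> y')
        = comm f g u - (?X \<odot> u + bracket ?Y u)"
        using gd_commutator[of x x' u y' y] by (simp add: comm_def algebra_simps)
      finally show "comm f g u - (?X \<odot> u + bracket ?Y u) \<in> W" .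
    next
      show "lin (comm f g)" using Flin fg by (intro lin_comm) auto
      show "comm f g u \<in> U" if "u \<in> U" for u
        unfolding comm_def using FU[OF fg(1)] FU[OF fg(2)] that by (simp add: subspace_diff[OF U])
      show "comm f g u \<in> W" if "u \<in> W" for u
        unfolding comm_def using FW[OF fg(1)] FW[OF fg(2)] that by (simp add: subspace_diff[OF W])
    qed
  qed
  have der: "h \<in> F k" if "der (F 0) k h" for k h
    using that by induction (use F_add F_comm in auto)
  have base: "(\<lambda>u. x \<odot> u + bracket y u) \<in> F 0" if "x \<in> D 0" "y \<in> D 0" for x y
  proof (rule FI[OF _ _ _ that])
    show "lin (\<lambda>u. x \<odot> u + bracket y u)" by (intro lin_plus lin_circ lin_bracket)
    show "x \<odot> u + bracket y u \<in> U" if "u \<in> U" for u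
      using opU \<open>x \<in> D 0\<close> \<open>y \<in> D 0\<close> that by (intro subspace_add[OF U])
    show "x \<odot> u + bracket y u \<in> W" if "u \<in> W" for u
      using opW \<open>x \<in> D 0\<close> \<open>y \<in> D 0\<close> that by (intro subspace_add[OF W])
  qed (simp add: W_simps)
  have adj': "adjacent (F 0) W U"
    unfolding adjacent_def
  proof (intro conjI allI impI)
    show "invariant (F 0) W" "invariant (F 0) U"
      using W U FU FW by (auto simp: invariant_def)
    show "W \<subset> U" using WU adjacentD(4)[OF adj] by blast
    fix X assume X: "invariant (F 0) X \<and> W \<subseteq> X \<and> X \<subseteq> U"
    have FX: "f v \<in> X" if "f \<in> F 0" "v \<in> X" for f v
      using X that by (auto simp: invariant_def)
    have "g v \<in> X" if g: "g \<in> gd_ops (D 0)" and v: "v \<in> X" for g v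
      using g
    proof (cases rule: gd_opsE)
      case (1 x)
      have "x \<odot> v + bracket 0 v \<in> X"
        by (rule FX[OF base[OF 1(1) subspace_0[OF D(1)]] v])
      then show ?thesis by (simp add: 1 bracket_simps)
    next
      case (2 x)
      then show ?thesis using R0[of x v] X v by auto
    next
      case (3 x)
      have "0 \<odot> v + bracket x v \<in> X"
        by (rule FX[OF base[OF subspace_0[OF D(1)] 3(1)] v])
      then show ?thesis by (simp add: 3 circ_simps)
    qed
    then have "invariant (gd_ops (D 0)) X" using X by (auto simp: invariant_def)
    then show "X = W \<or> X = U" using adjacentD(9)[OF adj] X by blast
  qed
  show ?thesis
  proof (rule solvable_commutes[OF adj', where n = n])
    show "comm f g \<in> F 0" if "f \<in> F 0" "g \<in> F 0" for f g
      using F_comm[OF that] F_mono by blast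
    show "f u \<in> W" if "der (F 0) n f" "u \<in> U" for f u
      using FE[OF der[OF that(1)]] D(4) that(2) by (auto simp: circ_simps bracket_simps)
    show "(\<lambda>u. x \<odot> u + bracket y u) \<in> F 0" "(\<lambda>u. x' \<odot> u + bracket y' u) \<in> F 0"
      by (intro base D0_elements)+
  qed (use Flin F_add u in auto)
qed

lemma gd_ops_zero_on_factor:
  assumes D: "\<And>k. subspace (D k)" "\<And>k. gd_prod (D k) (D k) \<subseteq> D (Suc k)" "\<And>k. D (Suc k) \<subseteq> D k"
    "D n = {0}"
    and nov: "novikov_nilpotent (D 0)" and nilp: "assoc_nilpotent (R_ad_ideal (D 0))"
    and ad: "D 0 \<subseteq> nilradical"
    and adj: "adjacent (gd_ops (D 0)) W U" and UD: "U \<subseteq> D 0"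
    and g: "g \<in> gd_ops (D 0)" and u: "u \<in> U"
  shows "g u \<in> W"
proof -
  note W = adjacentD(1)[OF adj] and U = adjacentD(2)[OF adj] and WU = adjacentD(3)[OF adj]
  have "gd_prod (D 0) (D 0) \<subseteq> D 0" using D(2)[of 0] D(3)[of 0] by blast
  then have B: "gd_subalgebra (D 0)"
    using D(1) gd_prodI[of _ "D 0" _ "D 0"] by (auto simp: gd_subalgebra_def)
  have R0: "u \<odot> x \<in> W" if "x \<in> D 0" "u \<in> U" for x u
    by (rule R_zero_on_factor[OF B nov nilp adj UD that])
  define H where "H = (\<Union>x\<in>D 0. {\<lambda>a. x \<odot> a, bracket x})"
  have H: "h \<in> gd_ops (D 0)" if "h \<in> H" for h using that by (auto simp: H_def gd_ops_def)
  have HE: "\<exists>x\<in>D 0. \<exists>y\<in>D 0. h = (\<lambda>u. x \<odot> u + bracket y u)" if hH: "h \<in> H" for h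
  proof -
    obtain x where "x \<in> D 0" "h = (\<lambda>a. x \<odot> a) \<or> h = bracket x" using hH by (auto simp: H_def)
    then have "h = (\<lambda>u. x \<odot> u + bracket 0 u) \<or> h = (\<lambda>u. 0 \<odot> u + bracket x u)"
      by (auto simp: circ_simps bracket_simps)
    then show ?thesis using \<open>x \<in> D 0\<close> subspace_0[OF D(1)] by blast
  qed
  have comm: "comm h h' u \<in> W" if h: "h \<in> H" "h' \<in> H" and u: "u \<in> U" for h h' u
  proof -
    obtain x y x' y' where "x \<in> D 0" "y \<in> D 0" "h = (\<lambda>u. x \<odot> u + bracket y u)"
      "x' \<in> D 0" "y' \<in> D 0" "h' = (\<lambda>u. x' \<odot> u + bracket y' u)"
      using HE[OF h(1)] HE[OF h(2)] by auto
    then show ?thesis using L_ad_commute_on_factor[OF D adj R0 _ _ _ _ u] by simp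
  qed
  have H0: "h u \<in> W" if h: "h \<in> H" and u: "u \<in> U" for h u
  proof (rule adjacent_kernel[OF adj, where H = H and h = h and u = u])
    fix h assume h: "h \<in> H"
    then obtain x where x: "x \<in> D 0" "h = (\<lambda>a. x \<odot> a) \<or> h = bracket x" by (auto simp: H_def)
    obtain m where m: "lower_central nilradical m = {0}"
      using lie_nilpotent_nilradical by (auto simp: lie_nilpotent_def)
    have pow: "(bracket x ^^ k) u \<in> lower_central nilradical k" if "u \<in> U" for u k
    proof (induction k)
      case 0
      then show ?case using that UD ad by auto
    next
      case (Suc k)
      show ?case
        unfolding lower_central.simps funpow.simps comp_def
        by (intro span_prodI Suc) (use x ad in auto)
    qed
    have "\<forall>u\<in>U. (bracket x ^^ m) u \<in> W" using pow[of _ m] subspace_0[OF W] by (auto simp: m)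
    moreover have "\<exists>n. \<forall>u\<in>U. ((\<lambda>a. x \<odot> a) ^^ n) u \<in> W"
      by (rule nilpotent_circ(1)[OF nov x(1) subspace_0[OF W] UD])
    ultimately show "\<exists>n. \<forall>u\<in>U. (h ^^ n) u \<in> W" using x(2) by blast
  next
    fix g h u assume g: "g \<in> gd_ops (D 0)" and h: "h \<in> H" and u: "u \<in> U"
      and killed: "\<And>h. h \<in> H \<Longrightarrow> h u \<in> W"
    show "h (g u) \<in> W"
    proof (cases "g \<in> H")
      case True
      have "comm h g u + g (h u) \<in> W"
        by (intro subspace_add[OF W] comm h True u adjacentD(8)[OF adj g] killed)
      then show ?thesis by (simp add: comm_def)
    next
      case False
      then obtain x where "x \<in> D 0" "g = (\<lambda>a. a \<odot> x)" using g by (auto simp: H_def gd_ops_def)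
      then show ?thesis using R0[of x u] u adjacentD(8)[OF adj H[OF h]] by auto
    qed
  qed (use h u comm H lin_gd_ops[of _ "D 0"] adjacentD(7,8)[OF adj] in auto)
  show ?thesis
  proof (cases "g \<in> H")
    case False
    then obtain x where "x \<in> D 0" "g = (\<lambda>a. a \<odot> x)" using g by (auto simp: H_def gd_ops_def)
    then show ?thesis using R0 u by auto
  qed (use H0 u in auto)
qed

text \<open>In a product of powers with exponents \<open>i\<close> and \<open>m - i\<close>, where \<open>m \<ge> 2\<^sup>k\<^sup>+\<^sup>1\<close>, one exponent is at least \<open>2\<^sup>k\<close>; the
other factor is applied as an operator.\<close>
lemma gd_power_descend:
  assumes B: "gd_subalgebra B"
  shows "2 ^ k \<le> m \<Longrightarrow> gd_power B m \<subseteq> descend (gd_ops B) B k"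
proof (induction k arbitrary: m)
  case 0
  then show ?case using gd_power_le[OF B] by simp
next
  case (Suc k)
  let ?D = "descend (gd_ops B) B (Suc k)"
  have sD: "subspace ?D" by simp
  have "(1::nat) \<le> 2 ^ k" by simp
  then have m: "m \<ge> 2" using Suc.prems unfolding power_Suc by linarith
  show ?case
  proof (rule power_series_minimal[OF m sD])
    fix i assume i: "1 \<le> i" "i < m"
    show "gd_prod (gd_power B i) (gd_power B (m - i)) \<subseteq> ?D"
    proof (rule gd_prod_minimal[OF sD])
      fix u v assume u: "u \<in> gd_power B i" and v: "v \<in> gd_power B (m - i)"
      have uB: "u \<in> B" "v \<in> B" using u v gd_power_le[OF B] by auto
      have op: "g w \<in> ?D" if "g \<in> gd_ops B" "w \<in> descend (gd_ops B) B k" for g w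
        using that by (auto intro!: span_base)
      have "2 ^ k \<le> i \<or> 2 ^ k \<le> m - i" using Suc.prems i by auto
      then have "u \<odot> v \<in> ?D \<and> bracket u v \<in> ?D"
      proof
        assume "2 ^ k \<le> i"
        then have u': "u \<in> descend (gd_ops B) B k" using Suc.IH u by blast
        have "bracket v u \<in> ?D" by (rule op[OF gd_opsI(3)[OF uB(2)] u'])
        then have "bracket u v \<in> ?D" unfolding bracket_anti[of u v] by (rule subspace_neg[OF sD])
        then show ?thesis using op[OF gd_opsI(2)[OF uB(2)] u'] by simp
      next
        assume "2 ^ k \<le> m - i"
        then have v': "v \<in> descend (gd_ops B) B k" using Suc.IH v by blast
        show ?thesis using op[OF gd_opsI(1)[OF uB(1)] v'] op[OF gd_opsI(3)[OF uB(1)] v'] by simp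
      qed
      then show "u \<odot> v \<in> ?D" "bracket u v \<in> ?D" by auto
    qed
  qed
qed

section \<open>The two implications\<close>

lemma gd_nilpotent_if:
  assumes solv: "gd_solvable" and circ: "span_prod circ UNIV UNIV \<subseteq> nilradical"
    and nov: "novikov_nilpotent (gd_derived 1)"
    and nilp: "assoc_nilpotent (R_ad_ideal (gd_derived 1))"
  shows "gd_nilpotent (gd_derived 1)"
proof -
  let ?B = "gd_derived 1"
  obtain N where N: "gd_derived N = {0}" using solv by (auto simp: gd_solvable_def)
  have "bracket x y \<in> nilradical" for x y
    by (rule bracket_in_nilradical[of gd_derived N])
      (use N subspace_gd_derived gd_prodI in auto)
  moreover have "x \<odot> y \<in> nilradical" for x y using circ span_prodI[of x UNIV y UNIV circ] by auto
  ultimately have B_nil: "?B \<subseteq> nilradical"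
    using gd_prod_minimal[OF lie_idealD(1)[OF lie_ideal_nilradical], of UNIV UNIV] by simp
  have B: "gd_subalgebra ?B" by (rule gd_subalgebra_derived)
  have "\<exists>n. descend (gd_ops ?B) ?B n = {0}"
  proof (rule descend_eventually_zero[where G = "gd_ops ?B"])
    show "invariant (gd_ops ?B) ?B"
      using gd_subalgebraD[OF B] by (auto simp: invariant_def gd_ops_def simp del: gd_derived.simps)
    have "gd_derived (Suc N) = {0}"
      using gd_derived_decreasing[of N] N subspace_0[OF subspace_gd_derived[of "Suc N"]] by auto
    moreover fix W X h x assume "adjacent (gd_ops ?B) W X" "X \<subseteq> ?B" "h \<in> gd_ops ?B" "x \<in> X"
    ultimately show "h x \<in> W"
      \<comment> \<open>The derived series of \<open>A\<close>, shifted so that it starts with \<open>B\<close>.\<close>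
      using gd_ops_zero_on_factor[of "\<lambda>k. gd_derived (Suc k)" N W X h x]
        subspace_gd_derived gd_derived_decreasing nov nilp B_nil
      by (simp del: gd_derived.simps add: gd_derived.simps(2)[symmetric])
  qed (rule lin_gd_ops)
  then obtain n where "descend (gd_ops ?B) ?B n = {0}" ..
  then have "gd_power ?B (2 ^ n) \<subseteq> {0}" using gd_power_descend[OF B, of n "2 ^ n"] by simp
  then have "gd_power ?B (2 ^ n) = {0}"
    using subspace_0[OF subspace_gd_power[OF gd_subalgebraD(1)[OF B]]] by blast
  then show ?thesis unfolding gd_nilpotent_def by (intro exI[of _ "2 ^ n"]) simp
qed

lemma novikov_nilpotent_if_gd_nilpotent:
  assumes B: "subspace B" and nilp: "gd_nilpotent B"
  shows "novikov_nilpotent B"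
proof -
  let ?ps = "power_series (span_prod circ) B"
  obtain N where N: "N \<ge> 1" "gd_power B N = {0}" using nilp by (auto simp: gd_nilpotent_def)
  have "?ps n \<subseteq> gd_power B n" for n
  proof (induction n rule: less_induct)
    case (less n)
    show ?case
    proof (cases "n \<ge> 2")
      case True
      show ?thesis
      proof (rule power_series_minimal[OF True subspace_gd_power[OF B]])
        fix i assume i: "1 \<le> i" "i < n"
        have "span_prod circ (?ps i) (?ps (n - i)) \<subseteq> gd_prod (gd_power B i) (gd_power B (n - i))"
          using less[of i] less[of "n - i"] i
          by (intro span_prod_minimal subspace_gd_prod gd_prodI) auto
        also have "\<dots> \<subseteq> gd_power B n" by (intro power_series_upper subspace_gd_prod i)
        finally show "span_prod circ (?ps i) (?ps (n - i)) \<subseteq> gd_power B n" .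
      qed
    next
      case False
      then have "n = 0 \<or> n = Suc 0" by auto
      then show ?thesis by auto
    qed
  qed
  then have "?ps N \<subseteq> {0}" unfolding N(2)[symmetric] .
  moreover have "0 \<in> ?ps N" by (intro subspace_0 subspace_power_series subspace_span_prod B)
  ultimately have "?ps N = {0}" by auto
  then show ?thesis using N unfolding novikov_nilpotent_def by blast
qed

lemma lie_nilpotent_if_gd_nilpotent:
  assumes B: "subspace B" and nilp: "gd_nilpotent B"
  shows "lie_nilpotent B"
proof -
  obtain N where N: "N \<ge> 1" "gd_power B N = {0}" using nilp by (auto simp: gd_nilpotent_def)
  have "lower_central B n \<subseteq> gd_power B (Suc n)" for n
  proof (induction n)
    case (Suc n)
    have "span_prod bracket B (lower_central B n) \<subseteq> gd_power B (Suc (Suc n))"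
      using Suc by (intro span_prod_minimal subspace_gd_power B gd_power_step(3)) auto
    then show ?case by simp
  qed simp
  from this[of "N - 1"] have "lower_central B (N - 1) \<subseteq> {0}" using N by simp
  moreover have "0 \<in> lower_central B (N - 1)"
    using subspace_0[OF B] subspace_0[OF subspace_span_prod] by (cases "N - 1") auto
  ultimately have "lower_central B (N - 1) = {0}" by blast
  then show ?thesis unfolding lie_nilpotent_def by blast
qed

text \<open>Elements of the multiplication algebra raise the filtration by powers of \<open>B\<close>, so every sufficiently
long product of them is zero.\<close>
lemma R_ad_ideal_nilpotent_if_gd_nilpotent:
  assumes B: "gd_subalgebra B" and nilp: "gd_nilpotent B"
  shows "assoc_nilpotent (R_ad_ideal B)"
proof -
  obtain N where N: "N \<ge> 1" "gd_power B N = {0}" using nilp by (auto simp: gd_nilpotent_def)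
  note sB = gd_subalgebraD(1)[OF B]
  let ?J = "R_ad_ideal B"
  have J_step: "f u \<in> gd_power B (Suc (Suc i))" if "f \<in> ?J" "u \<in> gd_power B (Suc i)" for f u i
  proof -
    have f: "f \<in> mult_algebra B" using that(1) R_ad_ideal_subset by blast
    have step: "x \<odot> u \<in> gd_power B (Suc (Suc i)) \<and> u \<odot> x \<in> gd_power B (Suc (Suc i))
      \<and> bracket x u \<in> gd_power B (Suc (Suc i))" if "x \<in> B" "u \<in> gd_power B (Suc i)" for i x u
      using gd_power_step[OF _ that(2,1)] by auto
    show ?thesis
      by (rule mult_algebra_filtered(2)[OF B, where X = "\<lambda>i. gd_power B (Suc i)"
            and Y = "\<lambda>i. gd_power B (Suc (Suc i))" and f = f and u = u])
        (fact gd_power_le[OF B] gd_power_decreasing[OF B] subspace_gd_power[OF sB] step f that(2))+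
  qed
  have JE: "assoc_power ?J n \<subseteq> End_on B" for n
    by (rule assoc_power_End[OF subset_trans[OF R_ad_ideal_subset mult_algebra_End[OF B]] sB])
  have pow: "f u \<in> gd_power B (Suc (Suc n))" if "f \<in> assoc_power ?J n" "u \<in> B" for f u n
    using that
  proof (induction n arbitrary: f)
    case 0
    then show ?case using J_step[of f u 0] by simp
  next
    case (Suc n)
    let ?F = "{f. f u \<in> gd_power B (Suc (Suc (Suc n)))}"
    have "fun_space.subspace ?F"
      using subspace_gd_power[OF sB, of "Suc (Suc (Suc n))"]
      by (intro fun_subspaceI) (simp_all add: subspace_def del: power_series.simps)
    moreover have "{f \<circ> g | f g. f \<in> ?J \<and> g \<in> assoc_power ?J n} \<subseteq> ?F"
      using J_step Suc.IH[OF _ Suc.prems(2)] by (auto simp del: power_series.simps)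
    ultimately have "fun_space.span {f \<circ> g | f g. f \<in> ?J \<and> g \<in> assoc_power ?J n} \<subseteq> ?F"
      by (intro fun_space.span_minimal)
    then show ?case using Suc.prems(1) by (auto simp del: power_series.simps)
  qed
  have zero: "gd_power B (Suc (Suc N)) \<subseteq> {0}"
    using gd_power_decreasing[OF B, of N] gd_power_decreasing[OF B, of "Suc N"] N by auto
  have "f = 0" if f: "f \<in> assoc_power ?J N" for f
  proof
    fix u
    have "f u = 0" if "u \<in> B" using pow[OF f that] zero by auto
    moreover have "f u = 0" if "u \<notin> B" using End_onD(2)[OF subsetD[OF JE f] that] .
    ultimately show "f u = 0 u" by (auto simp: zero_fun_def)
  qed
  moreover have "0 \<in> assoc_power ?J N" using N(1) by (cases N) (auto simp: fun_space.span_zero)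
  ultimately have "assoc_power ?J N = {0}" by blast
  then show ?thesis unfolding assoc_nilpotent_def by blast
qed

lemma gd_solvable_if_derived_nilpotent:
  assumes nilp: "gd_nilpotent (gd_derived 1)"
  shows "gd_solvable"
proof -
  let ?B = "gd_derived 1"
  obtain N where N: "N \<ge> 1" "gd_power ?B N = {0}" using nilp by (auto simp: gd_nilpotent_def)
  have "gd_derived (Suc n) \<subseteq> gd_power ?B (Suc n)" for n
  proof (induction n)
    case (Suc n)
    have "gd_derived (Suc (Suc n)) \<subseteq> gd_prod (gd_power ?B (Suc n)) (gd_power ?B 1)"
      unfolding gd_derived.simps(2)[of "Suc n"] using Suc gd_derived_le_1[of n]
      by (intro gd_prod_mono) (simp_all del: gd_derived.simps)
    also have "\<dots> \<subseteq> gd_power ?B (Suc n + 1)" by (intro power_series_mult subspace_gd_prod) auto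
    finally show ?case by simp
  qed simp
  from this[of "N - 1"] have "gd_derived (Suc (N - 1)) \<subseteq> {0}" using N by simp
  then show ?thesis
    using subspace_0[OF subspace_gd_derived] unfolding gd_solvable_def by blast
qed

lemma circ_in_nilradical_if_derived_nilpotent:
  assumes nilp: "gd_nilpotent (gd_derived 1)"
  shows "span_prod circ UNIV UNIV \<subseteq> nilradical"
proof -
  have "lie_ideal (gd_derived 1)"
    using subspace_gd_derived[of 1] gd_prodI[of _ UNIV _ UNIV] by (auto simp: lie_ideal_def)
  then have "gd_derived 1 \<subseteq> nilradical"
    using nilradical_upper lie_nilpotent_if_gd_nilpotent[OF subspace_gd_derived nilp] by blast
  moreover have "span_prod circ UNIV UNIV \<subseteq> gd_derived 1"
    using gd_prodI(1) by (intro span_prod_minimal subspace_gd_derived) auto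
  ultimately show ?thesis by blast
qed

end

theorem proposition4p9:
  fixes scale :: "'k::{alg_closed_field, field_char_0} \<Rightarrow> 'a::ab_group_add \<Rightarrow> 'a"
    and circ bracket :: "'a \<Rightarrow> 'a \<Rightarrow> 'a"
    and B :: "'a set"
  assumes A: "gd_algebra scale circ bracket"
    and finite_dim: "\<exists>S. finite S \<and> module.span scale S = (UNIV :: 'a set)"
    and B: "B = gd_algebra.gd_derived scale circ bracket 1"
  shows "gd_algebra.gd_nilpotent scale circ bracket B \<longleftrightarrow>
    gd_algebra.gd_solvable scale circ bracket \<and>
    vector_space.span_prod scale circ UNIV UNIV \<subseteq> lie_algebra.nilradical scale bracket \<and>
    novikov_algebra.novikov_nilpotent scale circ B \<and>
    gd_algebra.assoc_nilpotent scale (gd_algebra.R_ad_ideal scale circ bracket B)"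
proof -
  interpret A: gd_algebra scale circ bracket by (rule A)
  obtain S where S: "finite S" "A.span S = UNIV" using finite_dim by blast
  obtain Basis where Basis: "Basis \<subseteq> S" "A.independent Basis" "A.span Basis = UNIV"
    using A.maximal_independent_subset[of S] S
    by (metis A.span_mono A.span_span top.extremum_uniqueI)
  interpret A: fd_gd_algebra scale circ bracket Basis
    by unfold_locales (use Basis S finite_subset in auto)
  show ?thesis
    unfolding B
    using A.gd_nilpotent_if A.gd_solvable_if_derived_nilpotent
      A.circ_in_nilradical_if_derived_nilpotent
      A.novikov_nilpotent_if_gd_nilpotent[OF A.subspace_gd_derived]
      A.R_ad_ideal_nilpotent_if_gd_nilpotent[OF A.gd_subalgebra_derived]
    by blast
qed

end
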